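(* For an integer $n\ge3$, let $\Gamma_n$ be the disjoint union of the complete graph on $n-1$ vertices and one isolated vertex. Then \[\mathrm{Spec}_R(G_{\Gamma_n})=\begin{cases}2\mathbb{N}_0^2\cup 2|\mathbb{N}^2-4|_\infty\cup\{\infty\} & \text{if } n=3,\\ 2(2\mathbb{N}_0-1)\cup 8\mathbb{N}_0\cup\{\infty\} & \text{if } n\ge4.\end{cases}\]
   Context: For a finite undirected simple graph $\Gamma$ with vertex set $\{x_1,\dots,x_n\}$ and edge set $E$, the group $G_\Gamma$ is defined by the presentation with generators $x_1,\dots,x_n$ and $y_{i,j}$ for each pair $i<j$ with $x_ix_j\notin E$, and relations $[x_j,x_i]=1$ if $x_ix_j\in E$; $[x_j,x_i]=y_{i,j}$ if $x_ix_j\notin E$ and $i<j$; and $[x_l,y_{i,j}]=1$ for all $l$ and all such $y_{i,j}$. For a group $G$ and $\varphi\in\mathrm{Aut}(G)$, $R(\varphi)\in\mathbb{N}_0\cup\{\infty\}$ is the number of classes of $a\sim b\iff a=cb\varphi(c)^{-1}$ for some $c\in G$, and $\mathrm{Spec}_R(G)=\{R(\varphi):\varphi\in\mathrm{Aut}(G)\}$. Notation: $\mathbb{N}_0$ is the set of positive integers; $\mathbb{N}^2=\{m^2:m\in\mathbb{Z}\}$ and $\mathbb{N}_0^2=\{m^2: m\in\mathbb{Z}, m\neq0\}$; $|x|_\infty=|x|$ for $x\neq0$ and $|0|_\infty=\infty$, so $|\mathbb{N}^2-4|_\infty=\{|m^2-4|_\infty: m\in\mathbb{Z}\}$; for a set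 $A$ and integer $c$, $cA=\{ca:a\in A\}$ (with $c\cdot\infty=\infty$) and $2\mathbb{N}_0-1$ is the set of positive odd integers. *)

theory Defs
  imports "HOL-Algebra.Bij" "HOL-Library.Extended_Nat"
begin

text \<open>Words over a generating set: letters are pairs (generator, inverted?).\<close>

type_synonym 'a word = "('a \<times> bool) list"

definition words_on :: "'a set \<Rightarrow> 'a word set" where
  "words_on S = {w. fst ` set w \<subseteq> S}"

inductive pres_eqv :: "'a set \<Rightarrow> 'a word set \<Rightarrow> 'a word \<Rightarrow> 'a word \<Rightarrow> bool"
  for S :: "'a set" and R :: "'a word set" where
  refl: "w \<in> words_on S \<Longrightarrow> pres_eqv S R w w"
| sym: "pres_eqv S R u v \<Longrightarrow> pres_eqv S R v u"
| trans: "pres_eqv S R u v \<Longrightarrow> pres_eqv S R v w \<Longrightarrow> pres_eqv S R u w"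
| cancel: "u \<in> words_on S \<Longrightarrow> v \<in> words_on S \<Longrightarrow> x \<in> S \<Longrightarrow>
     pres_eqv S R (u @ [(x, b), (x, \<not> b)] @ v) (u @ v)"
| rel: "r \<in> R \<Longrightarrow> r \<in> words_on S \<Longrightarrow> u \<in> words_on S \<Longrightarrow> v \<in> words_on S \<Longrightarrow>
     pres_eqv S R (u @ r @ v) (u @ v)"

definition presented_group :: "'a set \<Rightarrow> 'a word set \<Rightarrow> 'a word set monoid" where
  "presented_group S R =
     \<lparr> carrier = {{v. pres_eqv S R w v} | w. w \<in> words_on S},
       mult = (\<lambda>A B. {v. \<exists>a\<in>A. \<exists>b\<in>B. pres_eqv S R (a @ b) v}),
       one = {v. pres_eqv S R [] v} \<rparr>"

datatype gen = X nat | Y nat nat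

definition comm_word :: "'a \<Rightarrow> 'a \<Rightarrow> 'a word" where
  "comm_word a b = [(a, True), (b, True), (a, False), (b, False)]"

text \<open>Graph on vertices x_1..x_n given by a symmetric edge predicate E on indices.\<close>

definition gg_gens :: "nat \<Rightarrow> (nat \<Rightarrow> nat \<Rightarrow> bool) \<Rightarrow> gen set" where
  "gg_gens n E = {X l | l. 1 \<le> l \<and> l \<le> n}
     \<union> {Y i j | i j. 1 \<le> i \<and> i < j \<and> j \<le> n \<and> \<not> E i j}"

definition gg_rels :: "nat \<Rightarrow> (nat \<Rightarrow> nat \<Rightarrow> bool) \<Rightarrow> gen word set" where
  "gg_rels n E =
     {comm_word (X j) (X i) | i j. 1 \<le> i \<and> i < j \<and> j \<le> n \<and> E i j}
   \<union> {comm_word (X j) (X i) @ [(Y i j, True)] | i j. 1 \<le> i \<and> i < j \<and> j \<le> n \<and> \<not> E i j}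
   \<union> {comm_word (X l) (Y i j) | l i j. 1 \<le> l \<and> l \<le> n \<and>
        1 \<le> i \<and> i < j \<and> j \<le> n \<and> \<not> E i j}"

definition graph_group :: "nat \<Rightarrow> (nat \<Rightarrow> nat \<Rightarrow> bool) \<Rightarrow> gen word set monoid" where
  "graph_group n E = presented_group (gg_gens n E) (gg_rels n E)"

definition Gamma_edge :: "nat \<Rightarrow> nat \<Rightarrow> nat \<Rightarrow> bool" where
  "Gamma_edge n i j \<longleftrightarrow> 1 \<le> i \<and> i < n \<and> 1 \<le> j \<and> j < n \<and> i \<noteq> j"

definition twisted_conj :: "('a, 'b) monoid_scheme \<Rightarrow> ('a \<Rightarrow> 'a) \<Rightarrow> ('a \<times> 'a) set" where
  "twisted_conj G \<phi> = {(a, b). a \<in> carrier G \<and> b \<in> carrier G \<and>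
      (\<exists>c\<in>carrier G. a = c \<otimes>\<^bsub>G\<^esub> b \<otimes>\<^bsub>G\<^esub> inv\<^bsub>G\<^esub> (\<phi> c))}"

definition reidemeister :: "('a, 'b) monoid_scheme \<Rightarrow> ('a \<Rightarrow> 'a) \<Rightarrow> enat" where
  "reidemeister G \<phi> =
     (let Q = carrier G // twisted_conj G \<phi> in if finite Q then enat (card Q) else \<infinity>)"

definition spec_R :: "('a, 'b) monoid_scheme \<Rightarrow> enat set" where
  "spec_R G = reidemeister G ` auto G"

end

theory Submission
  imports Defs "HOL-Library.Function_Algebras"
begin

text \<open>
  Put \<open>k = n - 1\<close>. The group is \<open>\<int>\<^sup>k \<times> \<int> \<times> \<int>\<^sup>k\<close> with
  \<open>(u, s, z) (u', s', z') = (u + u', s + s', z + z' + s u')\<close>. As \<open>k \<ge> 2\<close>, the abelian subgroup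
  \<open>s = 0\<close> is characteristic, so an automorphism sends \<open>(u, s, z)\<close> to
  \<open>(P u + s w, \<epsilon> s, \<epsilon> P z + q u s)\<close> with \<open>P \<in> GL\<^sub>k(\<int>)\<close> and \<open>\<epsilon> = \<plusminus>1\<close>.
  For \<open>\<epsilon> = 1\<close> the coordinate \<open>s\<close> is an invariant of twisted conjugacy and the
  Reidemeister number is infinite. For \<open>\<epsilon> = -1\<close> it is \<open>2\<close> times the product of the indices of the
  images of \<open>I - P\<close> and \<open>I + P\<close>.
  If \<open>k = 2\<close>, this product is \<open>|det (I - P) det (I + P)| = |(1 + det P)\<^sup>2 - (tr P)\<^sup>2|\<close>.
  If \<open>k \<ge> 3\<close>, the two indices have the same parity because \<open>I - P\<close> and \<open>I + P\<close> agree modulo 2,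
  and companion matrices realise every pair of determinants of equal parity.
\<close>

section \<open>Presented groups\<close>

text \<open>For \<epsilon> = -1 the twisted conjugacy equations are not three independent
  conditions: \<open>w\<close> and \<open>q\<close> mix the coordinates. They decouple because the
  equation for \<open>s\<close> fixes the middle coordinate of the conjugator, and a finite index of
  I - P makes I - P injective, which fixes its first coordinate as well; only a condition modulo the
  image of I + P survives. The plus sign appears since -P acts on the centre. If I - P has infinite
  index, the \<open>u\<close> coordinate alone separates infinitely many classes.

  Ranks 2 and at least 3 differ because the two determinants are, up to sign, the values of the
  characteristic polynomial at 1 and -1. In rank 2 with a given determinant only the trace is free.
  From rank 3 on, the coefficients of \<open>x\<close> and \<open>x^2\<close> are both free, and
  they enter the value at -1 with opposite signs, so both values can be prescribed once the parities
  agree. Parity is read off as surjectivity modulo 2, so no determinant of general rank is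
  formed.\<close>

lemma words_on_Nil [simp]: "[] \<in> words_on S"
  by (simp add: words_on_def)

lemma words_on_append [simp]: "u @ v \<in> words_on S \<longleftrightarrow> u \<in> words_on S \<and> v \<in> words_on S"
  by (auto simp: words_on_def)

lemma words_on_Cons [simp]: "a # w \<in> words_on S \<longleftrightarrow> fst a \<in> S \<and> w \<in> words_on S"
  by (auto simp: words_on_def)

lemma pres_eqv_words_on:
  assumes "pres_eqv S R u v"
  shows "u \<in> words_on S \<and> v \<in> words_on S"
  using assms by (induction rule: pres_eqv.induct) auto

lemma pres_eqv_context:
  assumes "pres_eqv S R u v" "a \<in> words_on S" "b \<in> words_on S"
  shows "pres_eqv S R (a @ u @ b) (a @ v @ b)"
  using assms
proof (induction rule: pres_eqv.induct)
  case (cancel u v x c)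
  then show ?case
    using pres_eqv.cancel[of "a @ u" S "v @ b" x R c] by simp
next
  case (rel r u v)
  then show ?case
    using pres_eqv.rel[of r R S "a @ u" "v @ b"] by simp
qed (auto intro: pres_eqv.intros)

lemma pres_eqv_append:
  assumes "pres_eqv S R u u'" "pres_eqv S R v v'"
  shows "pres_eqv S R (u @ v) (u' @ v')"
  using pres_eqv_context[OF assms(1), of "[]" v] pres_eqv_context[OF assms(2), of u' "[]"]
    pres_eqv_words_on[OF assms(1)] pres_eqv_words_on[OF assms(2)]
  by (auto intro: pres_eqv.trans)

definition word_class :: "'a set \<Rightarrow> 'a word set \<Rightarrow> 'a word \<Rightarrow> 'a word set" where
  "word_class S R w = {v. pres_eqv S R w v}"

lemma word_class_eq_iff:
  assumes "v \<in> words_on S"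
  shows "word_class S R u = word_class S R v \<longleftrightarrow> pres_eqv S R u v"
  using assms by (auto simp: word_class_def intro: pres_eqv.intros)

lemma carrier_presented_group: "carrier (presented_group S R) = word_class S R ` words_on S"
  by (auto simp: presented_group_def word_class_def)

lemma one_presented_group: "\<one>\<^bsub>presented_group S R\<^esub> = word_class S R []"
  by (simp add: presented_group_def word_class_def)

lemma mult_presented_group:
  assumes "u \<in> words_on S" "v \<in> words_on S"
  shows "word_class S R u \<otimes>\<^bsub>presented_group S R\<^esub> word_class S R v = word_class S R (u @ v)"
proof -
  have "pres_eqv S R (u @ v) w" if "pres_eqv S R u a" "pres_eqv S R v b" "pres_eqv S R (a @ b) w"
    for a b w
    using that by (meson pres_eqv.trans pres_eqv_append)
  then show ?thesis
    using assms by (auto simp: presented_group_def word_class_def intro: pres_eqv.refl)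
qed

definition inv_word :: "'a word \<Rightarrow> 'a word" where
  "inv_word w = rev (map (\<lambda>(x, b). (x, \<not> b)) w)"

lemma inv_word_words_on [simp]: "inv_word w \<in> words_on S \<longleftrightarrow> w \<in> words_on S"
  by (force simp: inv_word_def words_on_def)

lemma pres_eqv_inv_word:
  assumes "w \<in> words_on S"
  shows "pres_eqv S R (inv_word w @ w) []"
  using assms
proof (induction w)
  case Nil
  then show ?case by (simp add: inv_word_def pres_eqv.refl)
next
  case (Cons a w)
  obtain x b where a: "a = (x, b)" by (cases a)
  have "pres_eqv S R (inv_word w @ [(x, \<not> b), (x, \<not> \<not> b)] @ w) (inv_word w @ w)"
    using Cons.prems a by (intro pres_eqv.cancel) auto
  with Cons show ?case
    by (auto simp: a inv_word_def intro: pres_eqv.trans)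
qed

lemma group_presented_group: "group (presented_group S R)"
proof (rule groupI)
  fix x assume "x \<in> carrier (presented_group S R)"
  then obtain w where w: "w \<in> words_on S" "x = word_class S R w"
    by (auto simp: carrier_presented_group)
  then have "word_class S R (inv_word w) \<otimes>\<^bsub>presented_group S R\<^esub> x = \<one>\<^bsub>presented_group S R\<^esub>"
    by (simp add: mult_presented_group one_presented_group word_class_eq_iff pres_eqv_inv_word)
  with w show "\<exists>y\<in>carrier (presented_group S R). y \<otimes>\<^bsub>presented_group S R\<^esub> x = \<one>\<^bsub>presented_group S R\<^esub>"
    by (auto simp: carrier_presented_group)
qed (auto simp: carrier_presented_group one_presented_group mult_presented_group)

lemma inv_word_class:
  assumes "w \<in> words_on S"
  shows "inv\<^bsub>presented_group S R\<^esub> (word_class S R w) = word_class S R (inv_word w)"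
proof -
  interpret group "presented_group S R" by (rule group_presented_group)
  show ?thesis
    using assms
    by (intro inv_equality)
      (auto simp: carrier_presented_group one_presented_group mult_presented_group
        word_class_eq_iff pres_eqv_inv_word)
qed

section \<open>Evaluation of words and a criterion for identifying a presented group\<close>

fun eval_word :: "('b, 'c) monoid_scheme \<Rightarrow> ('a \<Rightarrow> 'b) \<Rightarrow> 'a word \<Rightarrow> 'b" where
  "eval_word G f [] = \<one>\<^bsub>G\<^esub>"
| "eval_word G f ((x, b) # w) = (if b then f x else inv\<^bsub>G\<^esub> f x) \<otimes>\<^bsub>G\<^esub> eval_word G f w"

context group
begin

lemma eval_word_closed [simp]:
  assumes "f \<in> S \<rightarrow> carrier G" "w \<in> words_on S"
  shows "eval_word G f w \<in> carrier G"
  using assms(2)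
proof (induction w)
  case (Cons a w)
  with assms(1) show ?case by (cases a) (auto simp: Pi_def)
qed simp

lemma eval_word_append:
  assumes "f \<in> S \<rightarrow> carrier G" "u \<in> words_on S" "v \<in> words_on S"
  shows "eval_word G f (u @ v) = eval_word G f u \<otimes> eval_word G f v"
  using assms(2)
proof (induction u)
  case Nil
  then show ?case using assms by simp
next
  case (Cons a u)
  with assms have "f (fst a) \<in> carrier G" by (auto simp: Pi_def)
  with Cons assms show ?case by (cases a) (auto simp: m_assoc)
qed

text \<open>Each rewriting step inserts or deletes a cancelling pair or a relator, and both evaluate
  to \<open>\<one>\<close>. This half of von Dyck's theorem gives injectivity in
  \<open>presented_group_iso\<close>.\<close>

lemma eval_word_pres_eqv:
  assumes f: "f \<in> S \<rightarrow> carrier G"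
    and R: "\<And>r. r \<in> R \<Longrightarrow> r \<in> words_on S \<Longrightarrow> eval_word G f r = \<one>"
    and "pres_eqv S R u v"
  shows "eval_word G f u = eval_word G f v"
  using assms(3)
proof (induction rule: pres_eqv.induct)
  case (cancel u v x b)
  moreover have "f x \<in> carrier G" using cancel f by (auto simp: Pi_def)
  ultimately show ?case
    using eval_word_append[OF f, of u "[(x, b), (x, \<not> b)] @ v"] eval_word_append[OF f, of u v] f
    by (cases b) (simp_all add: m_assoc[symmetric])
next
  case (rel r u v)
  then show ?case
    using eval_word_append[OF f, of u "r @ v"] eval_word_append[OF f, of r v]
      eval_word_append[OF f, of u v] R[of r] f
    by simp
qed simp_all

text \<open>\<open>\<psi>\<close> sends the value of a word to the class of that word, so it inverts evaluation.\<close>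

lemma presented_group_iso:
  assumes f: "f \<in> S \<rightarrow> carrier G"
    and R: "\<And>r. r \<in> R \<Longrightarrow> r \<in> words_on S \<Longrightarrow> eval_word G f r = \<one>"
    and \<psi>: "\<psi> \<in> hom G (presented_group S R)"
    and gens: "\<And>x. x \<in> S \<Longrightarrow> \<psi> (f x) = word_class S R [(x, True)]"
    and surj: "carrier G \<subseteq> eval_word G f ` words_on S"
  shows "\<psi> \<in> iso G (presented_group S R)"
proof -
  let ?P = "presented_group S R"
  interpret P: group ?P by (rule group_presented_group)
  interpret \<psi>: group_hom G ?P \<psi>
    using \<psi> by unfold_locales
  have eval: "\<psi> (eval_word G f w) = word_class S R w" if "w \<in> words_on S" for w
    using that
  proof (induction w)
    case Nil
    then show ?case by (simp add: one_presented_group)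
  next
    case (Cons a w)
    obtain x b where a: "a = (x, b)" by (cases a)
    have x: "x \<in> S" and w: "w \<in> words_on S" and fx: "f x \<in> carrier G"
      using Cons.prems f a by auto
    have "\<psi> (if b then f x else inv f x) = word_class S R [(x, b)]"
      using x fx gens[OF x] by (simp add: inv_word_class inv_word_def)
    then show ?case
      using Cons.IH[OF w] x w fx f
      by (auto simp: a mult_presented_group)
  qed
  show ?thesis
    unfolding iso_iff
  proof (intro conjI \<psi>)
    show "\<psi> ` carrier G = carrier ?P"
    proof
      show "carrier ?P \<subseteq> \<psi> ` carrier G"
      proof
        fix x assume "x \<in> carrier ?P"
        then obtain w where w: "w \<in> words_on S" "x = word_class S R w"
          by (auto simp: carrier_presented_group)
        then have "x = \<psi> (eval_word G f w)" "eval_word G f w \<in> carrier G"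
          using eval f by auto
        then show "x \<in> \<psi> ` carrier G" by blast
      qed
    qed auto
    show "inj_on \<psi> (carrier G)"
    proof (rule inj_onI)
      fix g h assume "g \<in> carrier G" "h \<in> carrier G" and eq: "\<psi> g = \<psi> h"
      then obtain u v where uv: "u \<in> words_on S" "v \<in> words_on S"
        "g = eval_word G f u" "h = eval_word G f v"
        using surj by blast
      with eq have "pres_eqv S R u v"
        by (simp add: eval word_class_eq_iff)
      then show "g = h"
        using eval_word_pres_eqv[OF f R] uv by simp
    qed
  qed
qed

end

section \<open>Counting classes of equivalence relations\<close>

definition ecard :: "'a set \<Rightarrow> enat" where
  "ecard A = (if finite A then enat (card A) else \<infinity>)"

lemma ecard_bij_betw: "bij_betw f A B \<Longrightarrow> ecard A = ecard B"
  by (simp add: ecard_def bij_betw_finite bij_betw_same_card)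

lemma ecard_inj_on: "inj_on f A \<Longrightarrow> ecard (f ` A) = ecard A"
  by (metis bij_betw_imageI ecard_bij_betw)

lemma ecard_Times:
  assumes "A \<noteq> {}" "B \<noteq> {}"
  shows "ecard (A \<times> B) = ecard A * ecard B"
  using assms by (auto simp: ecard_def card_cartesian_product finite_cartesian_product_iff zero_enat_def)

text \<open>\<open>f\<close> is a complete invariant, so the classes are its non-empty fibres and
  its values count them. Residues will play the role of \<open>f\<close>.\<close>

lemma ecard_quotient_eq_image:
  assumes "equiv A r" and f: "\<And>x y. x \<in> A \<Longrightarrow> y \<in> A \<Longrightarrow> (x, y) \<in> r \<longleftrightarrow> f x = f y"
  shows "ecard (A // r) = ecard (f ` A)"
proof -
  have cls: "r `` {x} = {y \<in> A. f y = f x}" if "x \<in> A" for x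
    using f[OF that] assms(1) that by (auto simp: equiv_def refl_on_def)
  have "A // r = (\<lambda>b. {y \<in> A. f y = b}) ` f ` A"
    using cls by (auto simp: quotient_def)
  moreover have "inj_on (\<lambda>b. {y \<in> A. f y = b}) (f ` A)"
    by (rule inj_onI) blast
  ultimately show ?thesis
    by (simp add: ecard_inj_on)
qed

lemma infinite_quotient:
  assumes "equiv A r" "S \<subseteq> A" "infinite S" "\<And>x y. x \<in> S \<Longrightarrow> y \<in> S \<Longrightarrow> (x, y) \<in> r \<Longrightarrow> x = y"
  shows "ecard (A // r) = \<infinity>"
proof -
  have "inj_on (\<lambda>x. r `` {x}) S"
    using assms by (auto intro!: inj_onI dest: eq_equiv_class)
  moreover have "(\<lambda>x. r `` {x}) ` S \<subseteq> A // r"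
    using assms(2) by (auto simp: quotient_def)
  ultimately have "infinite (A // r)"
    using assms(3) finite_subset finite_imageD by metis
  then show ?thesis by (simp add: ecard_def)
qed

text \<open>Counting representatives instead of classes lets a factorisation of the count appear as
  a product of sets.\<close>

definition transversal :: "'a set \<Rightarrow> ('a \<times> 'a) set \<Rightarrow> 'a set \<Rightarrow> bool" where
  "transversal A r T \<longleftrightarrow> T \<subseteq> A \<and> (\<forall>x\<in>A. \<exists>!t. t \<in> T \<and> (x, t) \<in> r)"

lemma transversal_exists:
  assumes "equiv A r"
  obtains T where "transversal A r T"
proof
  define rep where "rep x = (SOME t. t \<in> r `` {x})" for x
  have rep: "(x, rep x) \<in> r" if "x \<in> A" for x
    using assms that unfolding rep_def by (metis Image_singleton_iff equiv_class_self someI_ex)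
  have "rep x = rep y" if "(x, y) \<in> r" for x y
    using assms that equiv_class_eq unfolding rep_def by metis
  then show "transversal A r (rep ` A)"
    using rep assms unfolding transversal_def equiv_def sym_def trans_def refl_on_def
    by (smt (verit, best) image_iff subset_eq mem_Sigma_iff)
qed

text \<open>The projection onto \<open>T\<close> lets \<open>T\<close> stand in for the quotient:
  operations on classes become self-maps of \<open>T\<close> of the form
  \<open>rep (...)\<close>.\<close>

lemma transversal_rep:
  assumes "equiv A r" "transversal A r T"
  obtains rep where "rep ` A = T" "\<And>x y. x \<in> A \<Longrightarrow> y \<in> A \<Longrightarrow> (x, y) \<in> r \<longleftrightarrow> rep x = rep y"
    "\<And>t. t \<in> T \<Longrightarrow> rep t = t"
proof
  define f where "f x = (THE t. t \<in> T \<and> (x, t) \<in> r)" for x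
  have f: "f x \<in> T \<and> (x, f x) \<in> r" if "x \<in> A" for x
    unfolding f_def by (rule theI') (use assms(2) that in \<open>auto simp: transversal_def\<close>)
  have f_eq: "f x = t" if "x \<in> A" "t \<in> T" "(x, t) \<in> r" for x t
    using f[OF that(1)] assms(2) that unfolding transversal_def by blast
  show fixed: "f t = t" if t: "t \<in> T" for t
    using assms t by (intro f_eq) (auto simp: transversal_def equiv_def refl_on_def)
  show "f ` A = T"
    using f fixed assms(2) unfolding transversal_def by (metis image_subset_iff subset_antisym imageI subsetD subsetI)
  show "(x, y) \<in> r \<longleftrightarrow> f x = f y" if xy: "x \<in> A" "y \<in> A" for x y
  proof
    assume "(x, y) \<in> r"
    with f[OF xy(2)] assms(1) have "(x, f y) \<in> r"
      by (meson equiv_def transD)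
    with f_eq f xy show "f x = f y" by metis
  next
    assume "f x = f y"
    with f[OF xy(1)] f[OF xy(2)] assms(1) show "(x, y) \<in> r"
      by (metis equiv_def symD transD)
  qed
qed

lemma ecard_quotient_transversal:
  assumes "equiv A r" "transversal A r T"
  shows "ecard (A // r) = ecard T"
  using transversal_rep[OF assms] ecard_quotient_eq_image[OF assms(1)] by metis

text \<open>The orbits have two elements; remove one and induct. The involution of interest is
  negation on nonzero classes.\<close>

lemma even_card_involution:
  assumes "finite A" "\<And>x. x \<in> A \<Longrightarrow> f x \<in> A" "\<And>x. x \<in> A \<Longrightarrow> f (f x) = x" "\<And>x. x \<in> A \<Longrightarrow> f x \<noteq> x"
  shows "even (card A)"
  using assms
proof (induction "card A" arbitrary: A rule: less_induct)
  case less
  show ?case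
  proof (cases "A = {}")
    case False
    then obtain x where x: "x \<in> A" by blast
    let ?B = "A - {x, f x}"
    have sub: "{x, f x} \<subseteq> A" and two: "card {x, f x} = 2"
      using less.prems x by (auto simp: card_insert_if) metis
    then have card: "card A = card ?B + 2"
      using less.prems(1) by (metis card_Diff_subset card_mono finite.emptyI finite.insertI le_add_diff_inverse2)
    have "even (card ?B)"
    proof (rule less.hyps)
      show "f y \<in> ?B" if "y \<in> ?B" for y
        using that less.prems(2,3) x by (metis DiffD1 DiffD2 DiffI insertE insertI1 insertI2 singletonD)
    qed (use less.prems card in auto)
    then show ?thesis using card by simp
  qed simp
qed

section \<open>Reidemeister numbers\<close>

lemma reidemeister_ecard: "reidemeister G \<phi> = ecard (carrier G // twisted_conj G \<phi>)"
  by (simp add: reidemeister_def ecard_def Let_def)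

text \<open>Moving the inverse to the other side leaves an equation between products, which the
  model can compare coordinate by coordinate.\<close>

lemma (in group) twisted_conj_iff:
  assumes \<phi>: "\<phi> \<in> hom G G" and "a \<in> carrier G" "b \<in> carrier G"
  shows "(a, b) \<in> twisted_conj G \<phi> \<longleftrightarrow> (\<exists>c\<in>carrier G. a \<otimes> \<phi> c = c \<otimes> b)"
proof -
  have "a = c \<otimes> b \<otimes> inv (\<phi> c) \<longleftrightarrow> a \<otimes> \<phi> c = c \<otimes> b" if "c \<in> carrier G" for c
    using assms that hom_in_carrier[OF \<phi> that] by (metis inv_solve_right m_closed)
  then show ?thesis using assms by (auto simp: twisted_conj_def)
qed

lemma (in group) equiv_twisted_conj:
  assumes \<phi>: "\<phi> \<in> hom G G"
  shows "equiv (carrier G) (twisted_conj G \<phi>)"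
proof (rule equivI)
  note [simp] = hom_in_carrier[OF \<phi>] hom_mult[OF \<phi>] hom_one[OF \<phi>] is_group
  have [simp]: "\<phi> (inv c) = inv (\<phi> c)" if "c \<in> carrier G" for c
    using \<phi> that by (simp add: group_hom.hom_inv group_hom_axioms_def group_hom_def is_group)
  show "twisted_conj G \<phi> \<subseteq> carrier G \<times> carrier G"
    by (auto simp: twisted_conj_def)
  show "refl_on (carrier G) (twisted_conj G \<phi>)"
    by (auto simp: refl_on_def twisted_conj_def intro!: bexI[of _ \<one>])
  show "sym (twisted_conj G \<phi>)"
  proof (rule symI)
    fix a b assume "(a, b) \<in> twisted_conj G \<phi>"
    then obtain c where c: "c \<in> carrier G" "a \<in> carrier G" "b \<in> carrier G" "a = c \<otimes> b \<otimes> inv (\<phi> c)"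
      by (auto simp: twisted_conj_def)
    then have "b = inv c \<otimes> a \<otimes> inv (\<phi> (inv c))"
      by (simp add: m_assoc inv_solve_left)
    with c(1-3) inv_closed[OF c(1)] show "(b, a) \<in> twisted_conj G \<phi>"
      unfolding twisted_conj_def by blast
  qed
  show "trans (twisted_conj G \<phi>)"
  proof (rule transI)
    fix x y z assume "(x, y) \<in> twisted_conj G \<phi>" "(y, z) \<in> twisted_conj G \<phi>"
    then obtain c d where cd: "c \<in> carrier G" "d \<in> carrier G" "z \<in> carrier G" "x \<in> carrier G"
        "x = c \<otimes> y \<otimes> inv (\<phi> c)" "y = d \<otimes> z \<otimes> inv (\<phi> d)"
      by (auto simp: twisted_conj_def)
    then have "x = (c \<otimes> d) \<otimes> z \<otimes> inv (\<phi> (c \<otimes> d))"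
      by (simp add: m_assoc inv_mult_group)
    with cd(1-4) m_closed[OF cd(1,2)] show "(x, z) \<in> twisted_conj G \<phi>"
      unfolding twisted_conj_def by blast
  qed
qed

text \<open>\<open>h\<close> carries a transversal for \<open>\<phi>\<close> to one for
  \<open>\<psi>\<close>. Compatibility is asked only on the carrier, so with the identity as
  \<open>h\<close> the lemma also compares two maps that agree there.\<close>

lemma reidemeister_iso:
  assumes G: "group G" and H: "group H" and h: "h \<in> iso G H"
    and \<phi>: "\<phi> \<in> hom G G" and \<psi>: "\<psi> \<in> hom H H"
    and comm: "\<And>x. x \<in> carrier G \<Longrightarrow> \<psi> (h x) = h (\<phi> x)"
  shows "reidemeister H \<psi> = reidemeister G \<phi>"
proof -
  have hom: "h \<in> hom G H" and img: "h ` carrier G = carrier H" and inj: "inj_on h (carrier G)"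
    using h by (auto simp: iso_iff)
  note hc = hom_in_carrier[OF hom] hom_in_carrier[OF \<phi>]
  interpret G: group G by fact
  have tw: "(h a, h b) \<in> twisted_conj H \<psi> \<longleftrightarrow> (a, b) \<in> twisted_conj G \<phi>"
    if "a \<in> carrier G" "b \<in> carrier G" for a b
  proof -
    have "h a \<otimes>\<^bsub>H\<^esub> \<psi> (h c) = h c \<otimes>\<^bsub>H\<^esub> h b \<longleftrightarrow> a \<otimes>\<^bsub>G\<^esub> \<phi> c = c \<otimes>\<^bsub>G\<^esub> b" if "c \<in> carrier G" for c
      using that \<open>a \<in> carrier G\<close> \<open>b \<in> carrier G\<close> inj
      by (simp add: comm hc hom_mult[OF hom, symmetric] inj_on_eq_iff)
    then show ?thesis
      using that by (simp add: group.twisted_conj_iff G H \<phi> \<psi> hc flip: img)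
  qed
  obtain T where T: "transversal (carrier G) (twisted_conj G \<phi>) T"
    using transversal_exists[OF group.equiv_twisted_conj[OF G \<phi>]] .
  have "transversal (carrier H) (twisted_conj H \<psi>) (h ` T)"
    unfolding transversal_def
  proof (intro conjI ballI)
    show "h ` T \<subseteq> carrier H" using T img by (auto simp: transversal_def)
    fix y assume "y \<in> carrier H"
    then obtain x where x: "x \<in> carrier G" "y = h x" using img by blast
    obtain t where t: "t \<in> T" "(x, t) \<in> twisted_conj G \<phi>"
      and uniq: "\<And>t'. t' \<in> T \<Longrightarrow> (x, t') \<in> twisted_conj G \<phi> \<Longrightarrow> t' = t"
      using T x unfolding transversal_def by blast
    have TG: "T \<subseteq> carrier G" using T by (simp add: transversal_def)
    show "\<exists>!t. t \<in> h ` T \<and> (y, t) \<in> twisted_conj H \<psi>"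
    proof (rule ex1I[of _ "h t"])
      show "h t \<in> h ` T \<and> (y, h t) \<in> twisted_conj H \<psi>"
        using t TG tw x by blast
      show "s = h t" if "s \<in> h ` T \<and> (y, s) \<in> twisted_conj H \<psi>" for s
        using that uniq tw x TG by blast
    qed
  qed
  moreover have "ecard (h ` T) = ecard T"
    using T inj by (intro ecard_inj_on) (auto simp: transversal_def intro: inj_on_subset)
  ultimately show ?thesis
    using T G H \<phi> \<psi> by (simp add: reidemeister_ecard ecard_quotient_transversal group.equiv_twisted_conj)
qed

lemma auto_iff: "\<phi> \<in> auto G \<longleftrightarrow> \<phi> \<in> iso G G \<and> \<phi> \<in> extensional (carrier G)"
  by (auto simp: auto_def Bij_def iso_def)

lemma restrict_iso_auto:
  assumes "group G" "\<phi> \<in> iso G G"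
  shows "restrict \<phi> (carrier G) \<in> auto G"
  using assms unfolding auto_iff iso_def
  by (auto simp: hom_def Pi_def bij_betw_def group.is_monoid monoid.m_closed inj_on_def)

text \<open>\<open>auto\<close> admits only maps that are extensional on the carrier. Restriction
  does not change the Reidemeister number, so isomorphisms given by plain formulas may be
  used.\<close>

lemma spec_R_eq_isos:
  assumes G: "group G"
  shows "spec_R G = {reidemeister G \<phi> | \<phi>. \<phi> \<in> iso G G}"
proof -
  have "reidemeister G \<phi> \<in> spec_R G" if "\<phi> \<in> iso G G" for \<phi>
  proof -
    have "reidemeister G (restrict \<phi> (carrier G)) = reidemeister G \<phi>"
      using that restrict_iso_auto[OF G that] iso_set_refl G
      by (intro reidemeister_iso[where h = "\<lambda>x. x"]) (auto simp: auto_def iso_def)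
    then show ?thesis
      using restrict_iso_auto[OF G that] unfolding spec_R_def by (metis image_eqI)
  qed
  then show ?thesis
    by (auto simp: spec_R_def auto_iff)
qed

lemma spec_R_mono_iso:
  assumes G: "group G" and H: "group H" and h: "h \<in> iso G H"
  shows "spec_R G \<subseteq> spec_R H"
proof -
  have "reidemeister G \<phi> \<in> spec_R H" if \<phi>: "\<phi> \<in> iso G G" for \<phi>
  proof -
    let ?g = "inv_into (carrier G) h"
    let ?\<psi> = "h \<circ> (\<phi> \<circ> ?g)"
    have "?g \<in> iso H G" using group.iso_set_sym[OF G h] .
    then have \<psi>: "?\<psi> \<in> iso H H" using \<phi> h by (intro iso_set_trans)
    have "?\<psi> (h x) = h (\<phi> x)" if "x \<in> carrier G" for x
      using h that by (simp add: iso_iff inv_into_f_f)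
    then have "reidemeister H ?\<psi> = reidemeister G \<phi>"
      using \<psi> \<phi> by (intro reidemeister_iso[OF G H h]) (auto simp: iso_def)
    then show ?thesis
      using \<psi> unfolding spec_R_eq_isos[OF H] by (metis (mono_tags, lifting) mem_Collect_eq)
  qed
  then show ?thesis by (auto simp: spec_R_eq_isos[OF G])
qed

lemma spec_R_cong_iso:
  assumes "group G" "group H" "h \<in> iso G H"
  shows "spec_R G = spec_R H"
  using spec_R_mono_iso group.iso_set_sym assms by (metis subset_antisym)

section \<open>A concrete model\<close>

text \<open>\<open>\<int>\<^sup>k\<close> is encoded as the integer sequences supported on \<open>{1..k}\<close>.\<close>

definition vecs :: "nat \<Rightarrow> (nat \<Rightarrow> int) set" where
  "vecs k = {f. \<forall>i. i \<notin> {1..k} \<longrightarrow> f i = 0}"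

definition scale :: "int \<Rightarrow> (nat \<Rightarrow> int) \<Rightarrow> nat \<Rightarrow> int" where
  "scale m f = (\<lambda>i. m * f i)"

definition unit_vec :: "nat \<Rightarrow> nat \<Rightarrow> int" where
  "unit_vec i = (\<lambda>j. if j = i then 1 else 0)"

lemma scale_apply [simp]: "scale m f i = m * f i"
  by (simp add: scale_def)

lemma scale_simps [simp]:
  "scale 0 f = 0" "scale 1 f = f" "scale m 0 = 0" "scale (-1) f = -f" "scale (- m) f = - scale m f"
  "scale m (- f) = - scale m f"
  by (auto simp: scale_def fun_eq_iff)

lemma scale_scale [simp]: "scale a (scale b f) = scale (a * b) f"
  by (simp add: scale_def mult.assoc)

lemma scale_distribs:
  "scale (a + b) f = scale a f + scale b f" "scale a (f + g) = scale a f + scale a g"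
  "scale (a - b) f = scale a f - scale b f" "scale a (f - g) = scale a f - scale a g"
  by (auto simp: scale_def fun_eq_iff algebra_simps)

lemma vecs_closed [simp]:
  "0 \<in> vecs k"
  "f \<in> vecs k \<Longrightarrow> g \<in> vecs k \<Longrightarrow> f + g \<in> vecs k"
  "f \<in> vecs k \<Longrightarrow> g \<in> vecs k \<Longrightarrow> f - g \<in> vecs k"
  "f \<in> vecs k \<Longrightarrow> - f \<in> vecs k"
  "f \<in> vecs k \<Longrightarrow> scale m f \<in> vecs k"
  by (auto simp: vecs_def)

lemma unit_vec_vecs [simp]: "i \<in> {1..k} \<Longrightarrow> unit_vec i \<in> vecs k"
  by (auto simp: vecs_def unit_vec_def)

text \<open>A triple stands for the normal form \<open>x^u t^s c^z\<close>: \<open>u\<close> belongs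
  to the clique, \<open>s\<close> to the isolated vertex, \<open>z\<close> to the central
  generators. The term \<open>scale s u'\<close> is the central factor produced by moving
  \<open>t^s\<close> past \<open>x^u'\<close>.\<close>

definition heis :: "nat \<Rightarrow> ((nat \<Rightarrow> int) \<times> int \<times> (nat \<Rightarrow> int)) monoid" where
  "heis k = \<lparr>carrier = vecs k \<times> UNIV \<times> vecs k,
     mult = (\<lambda>(u, s, z) (u', s', z'). (u + u', s + s', z + z' + scale s u')),
     one = (0, 0, 0)\<rparr>"

lemma heis_simps [simp]:
  "(u, s, z) \<in> carrier (heis k) \<longleftrightarrow> u \<in> vecs k \<and> z \<in> vecs k"
  "(u, s, z) \<otimes>\<^bsub>heis k\<^esub> (u', s', z') = (u + u', s + s', z + z' + scale s u')"
  "\<one>\<^bsub>heis k\<^esub> = (0, 0, 0)"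
  by (auto simp: heis_def)

lemma group_heis: "group (heis k)"
proof (rule groupI)
  fix x assume "x \<in> carrier (heis k)"
  moreover obtain u s z where "x = (u, s, z)" by (cases x)
  ultimately show "\<exists>y\<in>carrier (heis k). y \<otimes>\<^bsub>heis k\<^esub> x = \<one>\<^bsub>heis k\<^esub>"
    by (intro bexI[of _ "(- u, - s, - z + scale s u)"]) auto
qed (auto simp: scale_distribs algebra_simps)

interpretation heis: group "heis k" by (rule group_heis)

lemma inv_heis:
  "u \<in> vecs k \<Longrightarrow> z \<in> vecs k \<Longrightarrow> inv\<^bsub>heis k\<^esub> (u, s, z) = (- u, - s, - z + scale s u)"
  by (rule heis.inv_equality) auto

section \<open>Normal forms\<close>

context group
begin

lemma int_pow_conj:
  assumes "g \<in> carrier G" "x \<in> carrier G"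
  shows "(g \<otimes> x \<otimes> inv g) [^] (m::int) = g \<otimes> x [^] m \<otimes> inv g"
proof -
  have "(\<lambda>x. g \<otimes> x \<otimes> inv g) \<in> hom G G"
    using assms(1) by (auto simp: hom_def m_assoc inv_solve_left)
  from hom_int_pow[OF this _ is_group is_group] show ?thesis
    using assms(2) by simp
qed

lemma int_pow_commute:
  assumes "x \<in> carrier G" "y \<in> carrier G" "x \<otimes> y = y \<otimes> x"
  shows "x [^] (m::int) \<otimes> y = y \<otimes> x [^] m"
proof -
  have "y \<otimes> x \<otimes> inv y = x"
    using assms by (metis inv_solve_right m_closed)
  then have "y \<otimes> x [^] m \<otimes> inv y = x [^] m"
    using int_pow_conj[OF assms(2,1), of m] by simp
  then show ?thesis
    using assms by (metis int_pow_closed inv_solve_right m_closed)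
qed

primrec ipow_prod :: "(nat \<Rightarrow> 'a) \<Rightarrow> (nat \<Rightarrow> int) \<Rightarrow> nat \<Rightarrow> 'a" where
  "ipow_prod g u 0 = \<one>"
| "ipow_prod g u (Suc k) = ipow_prod g u k \<otimes> g (Suc k) [^] u (Suc k)"

lemma ipow_prod_closed [simp]:
  "(\<And>i. i \<in> {1..k} \<Longrightarrow> g i \<in> carrier G) \<Longrightarrow> ipow_prod g u k \<in> carrier G"
  by (induction k) auto

lemma ipow_prod_commute:
  assumes "\<And>i. i \<in> {1..k} \<Longrightarrow> g i \<in> carrier G" "x \<in> carrier G"
    and "\<And>i. i \<in> {1..k} \<Longrightarrow> g i \<otimes> x = x \<otimes> g i"
  shows "ipow_prod g u k \<otimes> x = x \<otimes> ipow_prod g u k"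
  using assms
proof (induction k)
  case (Suc k)
  have IH: "ipow_prod g u k \<otimes> x = x \<otimes> ipow_prod g u k"
    using Suc by simp
  have "g (Suc k) [^] u (Suc k) \<otimes> x = x \<otimes> g (Suc k) [^] u (Suc k)"
    using Suc.prems by (intro int_pow_commute) auto
  moreover have "ipow_prod g u k \<in> carrier G" "g (Suc k) \<in> carrier G"
    using Suc.prems by (auto intro: ipow_prod_closed)
  ultimately show ?case
    using IH \<open>x \<in> carrier G\<close> by (metis ipow_prod.simps(2) int_pow_closed m_assoc)
qed simp

lemma ipow_prod_add:
  assumes g: "\<And>i. i \<in> {1..k} \<Longrightarrow> g i \<in> carrier G"
    and comm: "\<And>i j. i \<in> {1..k} \<Longrightarrow> j \<in> {1..k} \<Longrightarrow> g i \<otimes> g j = g j \<otimes> g i"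
  shows "ipow_prod g (u + v) k = ipow_prod g u k \<otimes> ipow_prod g v k"
  using assms
proof (induction k)
  case (Suc k)
  let ?a = "g (Suc k) [^] u (Suc k)" and ?b = "g (Suc k) [^] v (Suc k)"
  have "ipow_prod g v k \<otimes> ?a = ?a \<otimes> ipow_prod g v k"
    using Suc.prems by (intro ipow_prod_commute int_pow_commute[symmetric]) auto
  moreover have cl: "ipow_prod g w k \<in> carrier G" "g (Suc k) \<in> carrier G" for w
    using Suc.prems by (auto intro: ipow_prod_closed)
  ultimately have "ipow_prod g u k \<otimes> ipow_prod g v k \<otimes> (?a \<otimes> ?b) =
      (ipow_prod g u k \<otimes> ?a) \<otimes> (ipow_prod g v k \<otimes> ?b)"
    by (metis int_pow_closed m_assoc m_closed)
  with Suc cl show ?case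
    by (simp add: int_pow_mult)
qed simp

lemma ipow_prod_zero: "ipow_prod g (\<lambda>_. 0) k = \<one>"
  by (induction k) auto

lemma ipow_prod_unit_vec:
  assumes "\<And>i. i \<in> {1..k} \<Longrightarrow> g i \<in> carrier G" "i \<in> {1..k}"
  shows "ipow_prod g (unit_vec i) k = g i"
  using assms
proof (induction k)
  case (Suc k)
  show ?case
  proof (cases "i = Suc k")
    case True
    have "ipow_prod g (unit_vec i) j = \<one>" if "j \<le> k" for j
      using that True by (induction j) (auto simp: unit_vec_def)
    then show ?thesis
      using True Suc.prems by (simp add: unit_vec_def)
  next
    case False
    then show ?thesis
      using Suc by (auto simp: unit_vec_def)
  qed
qed simp

text \<open>As \<open>c i\<close> commutes with everything, commutators are bilinear in the
  exponents: \<open>t^s x_i^m = x_i^m c_i^(s m) t^s\<close>. The central factors are then collected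
  while \<open>k\<close> grows.\<close>

lemma int_pow_past_ipow_prod:
  assumes t: "t \<in> carrier G"
    and x: "\<And>i. i \<in> {1..k} \<Longrightarrow> x i \<in> carrier G"
    and c: "\<And>i. i \<in> {1..k} \<Longrightarrow> c i \<in> carrier G"
    and tx: "\<And>i. i \<in> {1..k} \<Longrightarrow> t \<otimes> x i = c i \<otimes> x i \<otimes> t"
    and central: "\<And>i y. i \<in> {1..k} \<Longrightarrow> y \<in> carrier G \<Longrightarrow> c i \<otimes> y = y \<otimes> c i"
  shows "t [^] (s::int) \<otimes> ipow_prod x u k = ipow_prod x u k \<otimes> ipow_prod c (scale s u) k \<otimes> t [^] s"
  using assms
proof (induction k)
  case (Suc k)
  let ?x = "x (Suc k)" and ?c = "c (Suc k)" and ?m = "u (Suc k)"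
  have k: "Suc k \<in> {1..Suc k}" by simp
  note xk = Suc.prems(2)[OF k] and ck = Suc.prems(3)[OF k] and txk = Suc.prems(4)[OF k]
    and cck = Suc.prems(5)[OF k]
  \<comment> \<open>Bilinearity comes in two halves: conjugating \<open>t\<close> by
    \<open>inv ?x\<close> yields the exponent \<open>s\<close>, then conjugating \<open>?x\<close>
    by \<open>t [^] s\<close> yields the exponent \<open>?m\<close>.\<close>
  have "inv ?x \<otimes> t \<otimes> ?x = inv ?x \<otimes> (?c \<otimes> ?x \<otimes> t)"
    using xk t txk by (simp add: m_assoc)
  also have "\<dots> = ?c \<otimes> t"
    using xk t ck cck[of "?x \<otimes> t"] cck[of t]
    by (simp add: m_assoc inv_solve_left')
  finally have "inv ?x \<otimes> t \<otimes> inv (inv ?x) = ?c \<otimes> t"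
    using xk by simp
  then have "inv ?x \<otimes> t [^] s \<otimes> inv (inv ?x) = (?c \<otimes> t) [^] s"
    using int_pow_conj[of "inv ?x" t s] t xk by simp
  also have "\<dots> = ?c [^] s \<otimes> t [^] s"
    using cck[of t] ck t by (intro int_pow_mult_distrib) auto
  finally have "t [^] s \<otimes> ?x = ?x \<otimes> ?c [^] s \<otimes> t [^] s"
    using xk t ck by (simp add: m_assoc inv_solve_left')
  also have "?x \<otimes> ?c [^] s = ?c [^] s \<otimes> ?x"
    using int_pow_commute[OF ck xk cck[OF xk]] by simp
  finally have "t [^] s \<otimes> ?x \<otimes> inv (t [^] s) = ?c [^] s \<otimes> ?x"
    using xk t ck by (simp add: m_assoc)
  then have "t [^] s \<otimes> ?x [^] ?m \<otimes> inv (t [^] s) = (?c [^] s \<otimes> ?x) [^] ?m"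
    using int_pow_conj[of "t [^] s" ?x ?m] xk t by simp
  also have "\<dots> = ?x [^] ?m \<otimes> ?c [^] (s * ?m)"
    using int_pow_commute[OF ck xk cck[OF xk], of s] ck xk
    by (simp add: int_pow_mult_distrib int_pow_pow)
  finally have step: "t [^] s \<otimes> ?x [^] ?m = ?x [^] ?m \<otimes> ?c [^] (s * ?m) \<otimes> t [^] s"
    using xk t ck by (metis inv_solve_right int_pow_closed m_closed)
  let ?K = "ipow_prod c (scale s u) k" and ?F = "ipow_prod x u k"
  have F: "?F \<in> carrier G" and K: "?K \<in> carrier G"
    using Suc.prems(2,3) by (auto intro: ipow_prod_closed)
  have KX: "?K \<otimes> ?x [^] ?m = ?x [^] ?m \<otimes> ?K"
    using Suc.prems by (intro ipow_prod_commute) auto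
  have "t [^] s \<otimes> ipow_prod x u (Suc k) = (t [^] s \<otimes> ?F) \<otimes> ?x [^] ?m"
    using F xk t by (simp add: m_assoc)
  also have "t [^] s \<otimes> ?F = ?F \<otimes> ?K \<otimes> t [^] s"
    using Suc by (simp del: scale_apply)
  also have "?F \<otimes> ?K \<otimes> t [^] s \<otimes> ?x [^] ?m = ?F \<otimes> ?K \<otimes> (t [^] s \<otimes> ?x [^] ?m)"
    using F K xk t by (simp add: m_assoc)
  also have "\<dots> = ?F \<otimes> (?K \<otimes> ?x [^] ?m) \<otimes> ?c [^] (s * ?m) \<otimes> t [^] s"
    unfolding step using F K xk t ck by (simp add: m_assoc)
  also have "\<dots> = ipow_prod x u (Suc k) \<otimes> ipow_prod c (scale s u) (Suc k) \<otimes> t [^] s"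
    unfolding KX using F K xk t ck by (simp add: m_assoc)
  finally show ?case .
qed simp

text \<open>The hypotheses are the defining relations, with \<open>c i\<close> as the commutator of
  \<open>t\<close> and \<open>x i\<close>. Collecting a product of two normal forms reproduces the
  multiplication of the model.\<close>

lemma heis_hom:
  assumes t: "t \<in> carrier G"
    and x: "\<And>i. i \<in> {1..k} \<Longrightarrow> x i \<in> carrier G"
    and c: "\<And>i. i \<in> {1..k} \<Longrightarrow> c i \<in> carrier G"
    and tx: "\<And>i. i \<in> {1..k} \<Longrightarrow> t \<otimes> x i = c i \<otimes> x i \<otimes> t"
    and xx: "\<And>i j. i \<in> {1..k} \<Longrightarrow> j \<in> {1..k} \<Longrightarrow> x i \<otimes> x j = x j \<otimes> x i"
    and central: "\<And>i y. i \<in> {1..k} \<Longrightarrow> y \<in> carrier G \<Longrightarrow> c i \<otimes> y = y \<otimes> c i"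
  shows "(\<lambda>(u, s, z). ipow_prod x u k \<otimes> t [^] (s::int) \<otimes> ipow_prod c z k) \<in> hom (heis k) G"
    (is "?h \<in> _")
proof -
  let ?F = "\<lambda>u. ipow_prod x u k" and ?K = "\<lambda>u. ipow_prod c u k"
  have F: "?F u \<in> carrier G" and K: "?K u \<in> carrier G" for u
    using x c by (auto intro: ipow_prod_closed)
  have K_central: "?K u \<otimes> y = y \<otimes> ?K u" if "y \<in> carrier G" for u y
    using that c central by (intro ipow_prod_commute) auto
  note FKt = F K t int_pow_closed m_closed
  have mult: "?F u \<otimes> t [^] s \<otimes> ?K z \<otimes> (?F u' \<otimes> t [^] s' \<otimes> ?K z') =
      ?F (u + u') \<otimes> t [^] (s + s') \<otimes> ?K (z + z' + scale s u')" for u s z u' s' z'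
  proof -
    have "?F u \<otimes> t [^] s \<otimes> ?K z \<otimes> (?F u' \<otimes> t [^] s' \<otimes> ?K z') =
        ?F u \<otimes> t [^] s \<otimes> (?K z \<otimes> (?F u' \<otimes> t [^] s')) \<otimes> ?K z'"
      by (simp add: m_assoc FKt)
    also have "\<dots> = ?F u \<otimes> (t [^] s \<otimes> ?F u') \<otimes> t [^] s' \<otimes> ?K z \<otimes> ?K z'"
      by (subst K_central) (simp_all add: m_assoc FKt)
    also have "t [^] s \<otimes> ?F u' = ?F u' \<otimes> (?K (scale s u') \<otimes> t [^] s)"
      using int_pow_past_ipow_prod[OF t x c tx central] by (simp add: m_assoc FKt)
    also have "?F u \<otimes> (?F u' \<otimes> (?K (scale s u') \<otimes> t [^] s)) \<otimes> t [^] s' \<otimes> ?K z \<otimes> ?K z' =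
        ?F u \<otimes> ?F u' \<otimes> (?K (scale s u') \<otimes> (t [^] s \<otimes> t [^] s' \<otimes> (?K z \<otimes> ?K z')))"
      by (simp add: m_assoc FKt)
    also have "\<dots> = (?F u \<otimes> ?F u') \<otimes> (t [^] s \<otimes> t [^] s') \<otimes> (?K z \<otimes> ?K z' \<otimes> ?K (scale s u'))"
      by (subst K_central) (simp_all add: m_assoc FKt)
    also have "\<dots> = ?F (u + u') \<otimes> t [^] (s + s') \<otimes> ?K (z + z' + scale s u')"
      using ipow_prod_add[OF x xx] ipow_prod_add[OF c central[OF _ c]] t by (simp add: int_pow_mult)
    finally show ?thesis .
  qed
  show ?thesis
  proof (rule homI)
    show "?h p \<in> carrier G" for p
      using FKt by (simp split: prod.split)
    show "?h (p \<otimes>\<^bsub>heis k\<^esub> q) = ?h p \<otimes> ?h q" for p q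
      by (cases p; cases q) (simp add: mult)
  qed
qed

end

text \<open>The unit vectors generate the lattice as a group; integer multiples reduce to repeated
  addition and negation.\<close>

lemma vecs_induct [consumes 1, case_names unit add minus]:
  assumes "u \<in> vecs k"
    and unit: "\<And>i. i \<in> {1..k} \<Longrightarrow> P (unit_vec i)"
    and add: "\<And>u v. u \<in> vecs k \<Longrightarrow> v \<in> vecs k \<Longrightarrow> P u \<Longrightarrow> P v \<Longrightarrow> P (u + v)"
    and minus: "\<And>u. u \<in> vecs k \<Longrightarrow> P u \<Longrightarrow> P (- u)"
    and zero: "P 0"
  shows "P u"
proof -
  have nat: "P (scale (int m) u)" if "u \<in> vecs k" "P u" for u m
    using that zero add by (induction m) (auto simp: scale_distribs)
  have scale: "P (scale m u)" if "u \<in> vecs k" "P u" for u m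
    using nat[OF that, of "nat \<bar>m\<bar>"] minus[of "scale (int (nat \<bar>m\<bar>)) u"] that
    by (cases "m \<ge> 0") auto
  have "P (\<Sum>i\<in>I. scale (u i) (unit_vec i)) \<and> (\<Sum>i\<in>I. scale (u i) (unit_vec i)) \<in> vecs k"
    if "I \<subseteq> {1..k}" for I
    using finite_subset[OF that finite_atLeastAtMost] that
    by (induction I) (auto intro!: zero add scale unit)
  moreover have "(\<Sum>i\<in>I. scale (u i) (unit_vec i)) j = (if j \<in> I then u j else 0)"
    if "finite I" for I j
    using that by (induction I) (auto simp: unit_vec_def)
  then have "(\<Sum>i\<in>{1..k}. scale (u i) (unit_vec i)) = u"
    using assms(1) by (auto simp: vecs_def)
  ultimately show ?thesis
    using order_refl[of "{1..k}"] by metis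
qed

lemma (in group) commute_inv:
  assumes "x \<in> carrier G" "y \<in> carrier G" "x \<otimes> y = y \<otimes> x"
  shows "x \<otimes> inv y = inv y \<otimes> x"
  using assms by (metis inv_closed inv_solve_left inv_solve_right m_assoc m_closed)

lemma (in group) commute_mult:
  assumes "x \<in> carrier G" "y \<in> carrier G" "z \<in> carrier G" "x \<otimes> y = y \<otimes> x" "x \<otimes> z = z \<otimes> x"
  shows "x \<otimes> (y \<otimes> z) = y \<otimes> z \<otimes> x"
  using assms by (metis m_assoc)

section \<open>The graph group of a complete graph plus a point\<close>

text \<open>The only missing edges join \<open>Suc k\<close> to the vertices \<open>1..k\<close>,
  which leaves exactly \<open>k\<close> generators \<open>Y i (Suc k)\<close>, one for each
  coordinate of \<open>z\<close>.\<close>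

lemma graph_group_iso_heis:
  assumes "k \<ge> 1"
  shows "\<exists>h. h \<in> iso (heis k) (graph_group (Suc k) (Gamma_edge (Suc k)))"
proof -
  let ?E = "Gamma_edge (Suc k)"
  define S where "S = gg_gens (Suc k) ?E"
  define R where "R = gg_rels (Suc k) ?E"
  have edge: "1 \<le> i \<and> i < j \<and> j \<le> Suc k \<and> ?E i j \<longleftrightarrow> 1 \<le> i \<and> i < j \<and> j \<le> k"
    and no_edge: "1 \<le> i \<and> i < j \<and> j \<le> Suc k \<and> \<not> ?E i j \<longleftrightarrow> i \<in> {1..k} \<and> j = Suc k" for i j
    by (auto simp: Gamma_edge_def)
  have XS: "X l \<in> S \<longleftrightarrow> l \<in> {1..Suc k}" and YS: "Y i j \<in> S \<longleftrightarrow> i \<in> {1..k} \<and> j = Suc k" for l i j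
    unfolding S_def gg_gens_def no_edge by auto
  have R_iff: "r \<in> R \<longleftrightarrow>
      (\<exists>i j. 1 \<le> i \<and> i < j \<and> j \<le> k \<and> r = comm_word (X j) (X i)) \<or>
      (\<exists>i\<in>{1..k}. r = comm_word (X (Suc k)) (X i) @ [(Y i (Suc k), True)]) \<or>
      (\<exists>l\<in>{1..Suc k}. \<exists>i\<in>{1..k}. r = comm_word (X l) (Y i (Suc k)))" for r
    unfolding R_def gg_rels_def edge no_edge Un_iff mem_Collect_eq
    by (auto simp del: One_nat_def) (metis atLeastAtMost_iff)
  let ?P = "presented_group S R"
  interpret P: group ?P by (rule group_presented_group)
  \<comment> \<open>The sign for \<open>Y\<close>: its relator makes \<open>Y i j\<close> the
    inverse of the commutator of \<open>X j\<close> and \<open>X i\<close>, and that commutator has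
    the value \<open>(0, 0, unit_vec i)\<close>.\<close>
  define f :: "gen \<Rightarrow> (nat \<Rightarrow> int) \<times> int \<times> (nat \<Rightarrow> int)" where
    "f g = (case g of X l \<Rightarrow> if l \<le> k then (unit_vec l, 0, 0) else (0, 1, 0)
      | Y i j \<Rightarrow> (0, 0, - unit_vec i))" for g
  have f: "f \<in> S \<rightarrow> carrier (heis k)"
  proof
    fix g assume "g \<in> S"
    then show "f g \<in> carrier (heis k)"
      by (cases g) (auto simp: f_def XS YS)
  qed
  define x where "x i = word_class S R [(X i, True)]" for i
  define y where "y i = word_class S R [(Y i (Suc k), True)]" for i
  define t where "t = x (Suc k)"
  define c where "c i = inv\<^bsub>?P\<^esub> y i" for i
  have x: "x i \<in> carrier ?P" if "i \<in> {1..Suc k}" for i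
    using that by (auto simp: x_def carrier_presented_group XS)
  have y: "y i \<in> carrier ?P" if "i \<in> {1..k}" for i
    using that by (auto simp: y_def carrier_presented_group YS)
  have t: "t \<in> carrier ?P" by (simp add: t_def x)
  have c: "c i \<in> carrier ?P" if "i \<in> {1..k}" for i
    using that by (auto simp: c_def y)
  have rel: "word_class S R r = \<one>\<^bsub>?P\<^esub>" if "r \<in> R" "r \<in> words_on S" for r
    using pres_eqv.rel[OF that, of "[]" "[]"] by (simp add: one_presented_group word_class_eq_iff)
  have comm_word: "word_class S R (comm_word a b) =
      word_class S R [(a, True)] \<otimes>\<^bsub>?P\<^esub> word_class S R [(b, True)] \<otimes>\<^bsub>?P\<^esub>
      inv\<^bsub>?P\<^esub> (word_class S R [(a, True)]) \<otimes>\<^bsub>?P\<^esub> inv\<^bsub>?P\<^esub> (word_class S R [(b, True)])"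
    if "a \<in> S" "b \<in> S" for a b
    using that by (simp add: comm_word_def inv_word_class inv_word_def mult_presented_group)
  have comm_iff: "a \<otimes>\<^bsub>?P\<^esub> b \<otimes>\<^bsub>?P\<^esub> inv\<^bsub>?P\<^esub> a \<otimes>\<^bsub>?P\<^esub> inv\<^bsub>?P\<^esub> b = d \<longleftrightarrow> a \<otimes>\<^bsub>?P\<^esub> b = d \<otimes>\<^bsub>?P\<^esub> b \<otimes>\<^bsub>?P\<^esub> a"
    if "a \<in> carrier ?P" "b \<in> carrier ?P" "d \<in> carrier ?P" for a b d
  proof -
    have "a \<otimes>\<^bsub>?P\<^esub> b \<otimes>\<^bsub>?P\<^esub> inv\<^bsub>?P\<^esub> a \<otimes>\<^bsub>?P\<^esub> inv\<^bsub>?P\<^esub> b = (a \<otimes>\<^bsub>?P\<^esub> b) \<otimes>\<^bsub>?P\<^esub> inv\<^bsub>?P\<^esub> (b \<otimes>\<^bsub>?P\<^esub> a)"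
      using that by (simp add: P.inv_mult_group P.m_assoc)
    also have "\<dots> = d \<longleftrightarrow> a \<otimes>\<^bsub>?P\<^esub> b = d \<otimes>\<^bsub>?P\<^esub> (b \<otimes>\<^bsub>?P\<^esub> a)"
      using that by (metis P.inv_solve_right P.m_closed)
    finally show ?thesis using that by (simp add: P.m_assoc)
  qed
  have xx_less: "x i \<otimes>\<^bsub>?P\<^esub> x j = x j \<otimes>\<^bsub>?P\<^esub> x i" if "1 \<le> i" "i < j" "j \<le> k" for i j
  proof -
    have "X i \<in> S" "X j \<in> S" using that by (auto simp: XS)
    moreover have "comm_word (X j) (X i) \<in> R" using that R_iff by blast
    ultimately have "word_class S R (comm_word (X j) (X i)) = \<one>\<^bsub>?P\<^esub>"
      by (intro rel) (auto simp: comm_word_def)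
    then show ?thesis
      using comm_iff[of "x j" "x i" "\<one>\<^bsub>?P\<^esub>"] x that comm_word \<open>X i \<in> S\<close> \<open>X j \<in> S\<close>
      by (simp add: x_def)
  qed
  have xx: "x i \<otimes>\<^bsub>?P\<^esub> x j = x j \<otimes>\<^bsub>?P\<^esub> x i" if "i \<in> {1..k}" "j \<in> {1..k}" for i j
    using xx_less[of i j] xx_less[of j i] that by (cases i j rule: linorder_cases) auto
  have xy: "x l \<otimes>\<^bsub>?P\<^esub> y i = y i \<otimes>\<^bsub>?P\<^esub> x l" if "l \<in> {1..Suc k}" "i \<in> {1..k}" for l i
  proof -
    have S: "X l \<in> S" "Y i (Suc k) \<in> S" using that by (auto simp: XS YS)
    moreover have "comm_word (X l) (Y i (Suc k)) \<in> R" using that R_iff by blast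
    ultimately have "word_class S R (comm_word (X l) (Y i (Suc k))) = \<one>\<^bsub>?P\<^esub>"
      by (intro rel) (auto simp: comm_word_def)
    then show ?thesis
      using comm_iff[of "x l" "y i" "\<one>\<^bsub>?P\<^esub>"] x y that comm_word S
      by (simp add: x_def y_def)
  qed
  have tx: "t \<otimes>\<^bsub>?P\<^esub> x i = c i \<otimes>\<^bsub>?P\<^esub> x i \<otimes>\<^bsub>?P\<^esub> t" if "i \<in> {1..k}" for i
  proof -
    have S: "X i \<in> S" "X (Suc k) \<in> S" "Y i (Suc k) \<in> S" using that by (auto simp: XS YS)
    have "comm_word (X (Suc k)) (X i) @ [(Y i (Suc k), True)] \<in> R" using that R_iff by blast
    then have "word_class S R (comm_word (X (Suc k)) (X i) @ [(Y i (Suc k), True)]) = \<one>\<^bsub>?P\<^esub>"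
      using S by (intro rel) (auto simp: comm_word_def)
    then have "word_class S R (comm_word (X (Suc k)) (X i)) \<otimes>\<^bsub>?P\<^esub> y i = \<one>\<^bsub>?P\<^esub>"
      using S unfolding y_def by (subst mult_presented_group) (auto simp: comm_word_def)
    moreover have "word_class S R (comm_word (X (Suc k)) (X i)) \<in> carrier ?P"
      using S by (auto simp: carrier_presented_group comm_word_def)
    ultimately have "word_class S R (comm_word (X (Suc k)) (X i)) = c i"
      using y[OF that] by (metis P.inv_equality P.inv_inv P.inv_closed c_def)
    then show ?thesis
      using comm_iff[of t "x i" "c i"] x t c that comm_word[OF S(2,1)]
      by (simp add: x_def t_def)
  qed
  have c_xy: "c i \<otimes>\<^bsub>?P\<^esub> x l = x l \<otimes>\<^bsub>?P\<^esub> c i" if "l \<in> {1..Suc k}" "i \<in> {1..k}" for l i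
    unfolding c_def by (rule P.commute_inv[symmetric]) (use that x y xy in auto)
  \<comment> \<open>The relators only make each \<open>Y\<close> commute with the \<open>X\<close>
    letters; two of the \<open>Y\<close> commute because each is the inverse of a commutator of
    \<open>X\<close> letters.\<close>
  have c_yy: "c i \<otimes>\<^bsub>?P\<^esub> y j = y j \<otimes>\<^bsub>?P\<^esub> c i" if "i \<in> {1..k}" "j \<in> {1..k}" for i j
  proof -
    have "c j = t \<otimes>\<^bsub>?P\<^esub> x j \<otimes>\<^bsub>?P\<^esub> inv\<^bsub>?P\<^esub> t \<otimes>\<^bsub>?P\<^esub> inv\<^bsub>?P\<^esub> (x j)"
      using comm_iff[of t "x j" "c j"] t x c tx that by simp
    moreover have "c i \<otimes>\<^bsub>?P\<^esub> \<dots> = \<dots> \<otimes>\<^bsub>?P\<^esub> c i"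
      unfolding t_def using that x c c_xy
      by (intro P.commute_mult P.commute_inv P.m_closed P.inv_closed) auto
    ultimately have "c i \<otimes>\<^bsub>?P\<^esub> c j = c j \<otimes>\<^bsub>?P\<^esub> c i" by simp
    from P.commute_inv[OF c[OF that(1)] c[OF that(2)] this] show ?thesis
      using that by (simp add: c_def y)
  qed
  have central_word: "c i \<otimes>\<^bsub>?P\<^esub> word_class S R w = word_class S R w \<otimes>\<^bsub>?P\<^esub> c i"
    if "i \<in> {1..k}" "w \<in> words_on S" for i w
    using that(2)
  proof (induction w)
    case Nil
    then show ?case using c[OF that(1)] by (simp add: one_presented_group[symmetric])
  next
    case (Cons a w)
    obtain g b where a: "a = (g, b)" by (cases a)
    have g: "g \<in> S" and w: "w \<in> words_on S" using Cons.prems a by auto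
    have carr: "word_class S R [(g, b)] \<in> carrier ?P" "word_class S R w \<in> carrier ?P" for b
      using g w by (auto simp: carrier_presented_group)
    have "c i \<otimes>\<^bsub>?P\<^esub> word_class S R [(g, True)] = word_class S R [(g, True)] \<otimes>\<^bsub>?P\<^esub> c i"
      using g that(1) c_xy c_yy by (cases g) (auto simp: XS YS x_def y_def)
    moreover from P.commute_inv[OF c[OF that(1)] carr(1) this]
    have "c i \<otimes>\<^bsub>?P\<^esub> word_class S R [(g, False)] = word_class S R [(g, False)] \<otimes>\<^bsub>?P\<^esub> c i"
      using g by (simp add: inv_word_class inv_word_def)
    ultimately have "c i \<otimes>\<^bsub>?P\<^esub> word_class S R [(g, b)] = word_class S R [(g, b)] \<otimes>\<^bsub>?P\<^esub> c i"
      by (cases b) auto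
    from P.commute_mult[OF c[OF that(1)] carr this Cons.IH[OF w]] show ?case
      using g w by (simp add: a mult_presented_group)
  qed
  then have central: "c i \<otimes>\<^bsub>?P\<^esub> g = g \<otimes>\<^bsub>?P\<^esub> c i" if "i \<in> {1..k}" "g \<in> carrier ?P" for i g
    using that by (auto simp: carrier_presented_group)
  define \<psi> where "\<psi> = (\<lambda>(u, s, z). P.ipow_prod x u k \<otimes>\<^bsub>?P\<^esub> t [^]\<^bsub>?P\<^esub> (s::int) \<otimes>\<^bsub>?P\<^esub> P.ipow_prod c z k)"
  have \<psi>: "\<psi> \<in> hom (heis k) ?P"
    unfolding \<psi>_def using t x c tx xx central by (intro P.heis_hom) auto
  have "\<psi> \<in> iso (heis k) ?P"
  proof (rule heis.presented_group_iso[OF f _ \<psi>])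
    fix r assume "r \<in> R"
    then show "eval_word (heis k) f r = \<one>\<^bsub>heis k\<^esub>"
      unfolding R_iff
      by (elim disjE exE conjE bexE)
        (auto simp: comm_word_def f_def inv_heis scale_distribs split: if_splits)
  next
    fix g assume g: "g \<in> S"
    have zero: "P.ipow_prod a (0 :: nat \<Rightarrow> int) k = \<one>\<^bsub>?P\<^esub>" for a
      using P.ipow_prod_zero[of a k] by (simp add: zero_fun_def)
    have unit_x: "P.ipow_prod x (unit_vec i) k = x i" if "i \<in> {1..k}" for i
      using that x by (intro P.ipow_prod_unit_vec) auto
    have unit_c: "P.ipow_prod c (unit_vec i) k = c i" if "i \<in> {1..k}" for i
      using that c by (intro P.ipow_prod_unit_vec) auto
    show "\<psi> (f g) = word_class S R [(g, True)]"
    proof (cases g)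
      case (X l)
      then show ?thesis
        using g x[of l] t by (auto simp: \<psi>_def f_def XS zero unit_x x_def t_def le_Suc_eq)
    next
      case (Y i j)
      then have i: "i \<in> {1..k}" "j = Suc k" using g YS by auto
      interpret \<psi>: group_hom "heis k" ?P \<psi> using \<psi> by unfold_locales
      have "f g = inv\<^bsub>heis k\<^esub> (0, 0, unit_vec i)" using i by (simp add: f_def Y inv_heis)
      moreover have "\<psi> (0, 0, unit_vec i) = c i"
        using i c by (simp add: \<psi>_def zero unit_c)
      ultimately have "\<psi> (f g) = inv\<^bsub>?P\<^esub> c i"
        using i \<psi>.hom_inv[of "(0, 0, unit_vec i)"] by simp
      then show ?thesis using i y by (simp add: c_def y_def Y)
    qed
  next
    let ?ev = "eval_word (heis k) f ` words_on S"
    \<comment> \<open>Surjectivity of evaluation: its image is closed under products and contains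
      the three coordinate subgroups, and every triple is a product of one element from
      each.\<close>
    have mult: "a \<otimes>\<^bsub>heis k\<^esub> b \<in> ?ev" if ab: "a \<in> ?ev" "b \<in> ?ev" for a b
    proof -
      obtain v w where vw: "v \<in> words_on S" "w \<in> words_on S"
          "a = eval_word (heis k) f v" "b = eval_word (heis k) f w"
        using ab by blast
      then show ?thesis
        using heis.eval_word_append[OF f, of v w] by (intro image_eqI[of _ _ "v @ w"]) auto
    qed
    have gen: "f g \<in> ?ev" "inv\<^bsub>heis k\<^esub> f g \<in> ?ev" if "g \<in> S" for g
    proof -
      have "f g \<in> carrier (heis k)" using f that by auto
      then have "f g = eval_word (heis k) f [(g, True)]"
          "inv\<^bsub>heis k\<^esub> f g = eval_word (heis k) f [(g, False)]"
        by (simp_all del: heis_simps)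
      then show "f g \<in> ?ev" "inv\<^bsub>heis k\<^esub> f g \<in> ?ev"
        using that by (metis imageI words_on_Cons words_on_Nil fst_conv)+
    qed
    have one: "(0, 0, 0) \<in> ?ev" by (auto intro!: image_eqI[of _ _ "[]"])
    have "(u, 0, 0) \<in> ?ev \<and> (- u, 0, 0) \<in> ?ev" if "u \<in> vecs k" for u
      using that
    proof (induction rule: vecs_induct)
      case (unit i)
      then have "f (X i) = (unit_vec i, 0, 0)" by (simp add: f_def)
      then have "(unit_vec i, 0, 0) \<in> ?ev" "(- unit_vec i, 0, 0) \<in> ?ev"
        using gen[of "X i"] unit by (simp_all add: XS inv_heis)
      then show ?case by (rule conjI)
    next
      case (add u v)
      then show ?case
        using mult[of "(u, 0, 0)" "(v, 0, 0)"] mult[of "(- u, 0, 0)" "(- v, 0, 0)"]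
        by (simp del: zero_fun_apply uminus_apply plus_fun_apply minus_apply)
    qed (use one in \<open>auto simp del: zero_fun_apply uminus_apply\<close>)
    moreover have "(0, 0, z) \<in> ?ev \<and> (0, 0, - z) \<in> ?ev" if "z \<in> vecs k" for z
      using that
    proof (induction rule: vecs_induct)
      case (unit i)
      have "f (Y i (Suc k)) = (0, 0, - unit_vec i)" by (simp add: f_def)
      then have "(0, 0, unit_vec i) \<in> ?ev" "(0, 0, - unit_vec i) \<in> ?ev"
        using gen[of "Y i (Suc k)"] unit by (simp_all add: YS inv_heis)
      then show ?case by (rule conjI)
    next
      case (add u v)
      then show ?case
        using mult[of "(0, 0, u)" "(0, 0, v)"] mult[of "(0, 0, - u)" "(0, 0, - v)"]
        by (simp del: zero_fun_apply uminus_apply plus_fun_apply minus_apply)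
    qed (use one in \<open>auto simp del: zero_fun_apply uminus_apply\<close>)
    moreover have "(0, s, 0) \<in> ?ev" for s
    proof -
      have "f (X (Suc k)) = (0, 1, 0)" by (simp add: f_def)
      then have T: "(0, 1, 0) \<in> ?ev" "(0, -1, 0) \<in> ?ev"
        using gen[of "X (Suc k)"] by (simp_all add: XS inv_heis)
      have "(0, int m, 0) \<in> ?ev \<and> (0, - int m, 0) \<in> ?ev" for m
      proof (induction m)
        case (Suc m)
        then show ?case
          using mult[of "(0, int m, 0)" "(0, 1, 0)"] mult[of "(0, - int m, 0)" "(0, -1, 0)"] T
          by (simp add: algebra_simps del: zero_fun_apply)
      qed (use one in \<open>auto simp del: zero_fun_apply\<close>)
      from this[of "nat \<bar>s\<bar>"] show ?thesis by (cases "s \<ge> 0") auto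
    qed
    ultimately have "(u, 0, 0) \<otimes>\<^bsub>heis k\<^esub> (0, s, 0) \<otimes>\<^bsub>heis k\<^esub> (0, 0, z) \<in> ?ev"
      if "u \<in> vecs k" "z \<in> vecs k" for u s z
      using that mult by presburger
    then show "carrier (heis k) \<subseteq> ?ev" by auto
  qed
  then show ?thesis
    unfolding graph_group_def S_def R_def by blast
qed

section \<open>Indices of images of endomorphisms of \<open>\<int>\<^sup>k\<close>\<close>

definition endo :: "nat \<Rightarrow> ((nat \<Rightarrow> int) \<Rightarrow> (nat \<Rightarrow> int)) \<Rightarrow> bool" where
  "endo k D \<longleftrightarrow> D ` vecs k \<subseteq> vecs k \<and> (\<forall>u\<in>vecs k. \<forall>v\<in>vecs k. D (u + v) = D u + D v)"

definition coset_rel :: "nat \<Rightarrow> ((nat \<Rightarrow> int) \<Rightarrow> (nat \<Rightarrow> int)) \<Rightarrow> ((nat \<Rightarrow> int) \<times> (nat \<Rightarrow> int)) set" where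
  "coset_rel k D = {(u, v). u \<in> vecs k \<and> v \<in> vecs k \<and> u - v \<in> D ` vecs k}"

text \<open>The order of the cokernel of \<open>D\<close>, which replaces the absolute value of its
  determinant in arbitrary rank.\<close>

definition index :: "nat \<Rightarrow> ((nat \<Rightarrow> int) \<Rightarrow> (nat \<Rightarrow> int)) \<Rightarrow> enat" where
  "index k D = ecard (vecs k // coset_rel k D)"

lemma coset_rel_iff [simp]:
  "(u, v) \<in> coset_rel k D \<longleftrightarrow> u \<in> vecs k \<and> v \<in> vecs k \<and> u - v \<in> D ` vecs k"
  by (simp add: coset_rel_def)

text \<open>The absolute value \<open>|m|\<^sub>\<infinity>\<close> of the paper.\<close>

definition iabs :: "int \<Rightarrow> enat" where
  "iabs m = (if m = 0 then \<infinity> else enat (nat \<bar>m\<bar>))"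

text \<open>For \<open>m = 0\<close> the map \<open>j mod 0\<close> is the identity, so its infinite
  range agrees with \<open>iabs 0 = \<infinity>\<close>.\<close>

lemma ecard_range_mod: "ecard (range (\<lambda>j. j mod \<bar>m\<bar>)) = iabs m" for m :: int
proof (cases "m = 0")
  case True
  then show ?thesis by (simp add: ecard_def iabs_def)
next
  case False
  have "range (\<lambda>j. j mod \<bar>m\<bar>) = {0..<\<bar>m\<bar>}"
  proof
    show "{0..<\<bar>m\<bar>} \<subseteq> range (\<lambda>j. j mod \<bar>m\<bar>)"
    proof
      fix j assume "j \<in> {0..<\<bar>m\<bar>}"
      then have "j = j mod \<bar>m\<bar>" by simp
      then show "j \<in> range (\<lambda>j. j mod \<bar>m\<bar>)" by blast
    qed
  qed (use False in auto)
  then show ?thesis using False by (simp add: ecard_def iabs_def)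
qed

context
  fixes k D
  assumes D: "endo k D"
begin

lemma endo_closed [simp]: "u \<in> vecs k \<Longrightarrow> D u \<in> vecs k"
  and endo_add: "u \<in> vecs k \<Longrightarrow> v \<in> vecs k \<Longrightarrow> D (u + v) = D u + D v"
  using D by (auto simp: endo_def)

lemma endo_zero: "D 0 = 0"
  using endo_add[of 0 0] by simp

lemma endo_minus: "u \<in> vecs k \<Longrightarrow> D (- u) = - D u"
  using endo_add[of u "- u"] by (simp add: endo_zero eq_neg_iff_add_eq_0 add.commute)

lemma endo_diff: "u \<in> vecs k \<Longrightarrow> v \<in> vecs k \<Longrightarrow> D (u - v) = D u - D v"
  using endo_add[of u "- v"] by (simp add: endo_minus)

lemma endo_scale:
  assumes "u \<in> vecs k"
  shows "D (scale m u) = scale m (D u)"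
proof -
  have nat: "D (scale (int n) u) = scale (int n) (D u)" for n
    using assms by (induction n) (simp_all add: scale_distribs endo_add endo_zero)
  show ?thesis
    using nat[of "nat \<bar>m\<bar>"] endo_minus[of "scale \<bar>m\<bar> u"] assms by (cases "m \<ge> 0") auto
qed

lemma image_add: "u \<in> D ` vecs k \<Longrightarrow> v \<in> D ` vecs k \<Longrightarrow> u + v \<in> D ` vecs k"
  by (auto simp: endo_add[symmetric])

lemma image_minus: "u \<in> D ` vecs k \<Longrightarrow> - u \<in> D ` vecs k"
  by (auto simp: endo_minus[symmetric])

lemma image_diff: "u \<in> D ` vecs k \<Longrightarrow> v \<in> D ` vecs k \<Longrightarrow> u - v \<in> D ` vecs k"
  by (auto simp: endo_diff[symmetric])

lemma image_zero: "0 \<in> D ` vecs k"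
  using endo_zero by (metis imageI vecs_closed(1))

lemma image_sum: "(\<And>x. x \<in> A \<Longrightarrow> f x \<in> D ` vecs k) \<Longrightarrow> sum f A \<in> D ` vecs k"
  by (induction A rule: infinite_finite_induct) (auto intro: image_add image_zero)

lemma equiv_coset_rel: "equiv (vecs k) (coset_rel k D)"
proof (rule equivI)
  show "coset_rel k D \<subseteq> vecs k \<times> vecs k" by auto
  show "refl_on (vecs k) (coset_rel k D)" by (auto simp: refl_on_def image_zero)
  show "sym (coset_rel k D)"
  proof (rule symI)
    fix u v assume "(u, v) \<in> coset_rel k D"
    then show "(v, u) \<in> coset_rel k D"
      using image_minus[of "u - v"] by simp
  qed
  show "trans (coset_rel k D)"
  proof (rule transI)
    fix u v w assume "(u, v) \<in> coset_rel k D" "(v, w) \<in> coset_rel k D"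
    then show "(u, w) \<in> coset_rel k D"
      using image_add[of "u - v" "v - w"] by simp
  qed
qed

text \<open>Lagrange for the cokernel: translation by \<open>x\<close> permutes the representatives,
  so summing \<open>t + x - rep (t + x)\<close> over \<open>T\<close> leaves \<open>N\<close> copies
  of \<open>x\<close>, while each summand lies in the image.\<close>

lemma index_multiple:
  assumes "index k D = enat N"
  shows "N > 0" "x \<in> vecs k \<Longrightarrow> scale (int N) x \<in> D ` vecs k"
proof -
  obtain T where T: "transversal (vecs k) (coset_rel k D) T"
    using transversal_exists[OF equiv_coset_rel] .
  have "ecard T = enat N"
    using ecard_quotient_transversal[OF equiv_coset_rel T] assms by (simp add: index_def)
  then have fin: "finite T" and card: "card T = N"
    by (auto simp: ecard_def split: if_splits)
  obtain rep where rep: "rep ` vecs k = T"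
    "\<And>u v. u \<in> vecs k \<Longrightarrow> v \<in> vecs k \<Longrightarrow> (u, v) \<in> coset_rel k D \<longleftrightarrow> rep u = rep v"
    "\<And>t. t \<in> T \<Longrightarrow> rep t = t"
    using transversal_rep[OF equiv_coset_rel T] by metis
  have TV: "T \<subseteq> vecs k" using T by (simp add: transversal_def)
  show "N > 0"
    using rep(1) fin card vecs_closed(1) by (metis card_gt_0_iff image_is_empty empty_iff)
  show "scale (int N) x \<in> D ` vecs k" if x: "x \<in> vecs k"
  proof -
    have eq: "u - v \<in> D ` vecs k \<longleftrightarrow> rep u = rep v" if "u \<in> vecs k" "v \<in> vecs k" for u v
      using rep(2)[OF that] that by simp
    have rep_T: "rep u \<in> T" if "u \<in> vecs k" for u using rep(1) that by blast
    have "inj_on (\<lambda>t. rep (t + x)) T"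
    proof (rule inj_onI)
      fix t t' assume t: "t \<in> T" "t' \<in> T" "rep (t + x) = rep (t' + x)"
      then have "t - t' \<in> D ` vecs k"
        using eq[of "t + x" "t' + x"] x subsetD[OF TV t(1)] subsetD[OF TV t(2)] by simp
      then show "t = t'" using eq[of t t'] t rep(3) TV by auto
    qed
    moreover have "(\<lambda>t. rep (t + x)) ` T \<subseteq> T" using rep_T x TV by auto
    ultimately have perm: "bij_betw (\<lambda>t. rep (t + x)) T T"
      using fin by (simp add: bij_betw_def endo_inj_surj)
    have "(\<Sum>t\<in>T. t + x - rep (t + x)) \<in> D ` vecs k"
    proof (rule image_sum)
      fix t assume "t \<in> T"
      then have V: "t + x \<in> vecs k" "rep (t + x) \<in> T" using x TV rep_T by auto
      then show "t + x - rep (t + x) \<in> D ` vecs k"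
        using eq[of "t + x" "rep (t + x)"] rep(3) TV by auto
    qed
    moreover have "(\<Sum>t\<in>T. t + x - rep (t + x)) = (\<Sum>t\<in>T. x)"
      using sum.reindex_bij_betw[OF perm, of "\<lambda>t. t"] by (simp add: sum_subtractf sum.distrib)
    moreover have "(\<Sum>t\<in>T. x) = scale (int (card T)) x"
      using fin by (induction T) (simp_all add: scale_def fun_eq_iff algebra_simps)
    ultimately show ?thesis using card by simp
  qed
qed

text \<open>If the index is \<open>N\<close>, then \<open>D\<close> is surjective, hence injective, modulo \<open>p = N + 1\<close>;
  so kernel vectors are divisible by every power of \<open>p\<close>.\<close>

lemma index_finite_inj:
  assumes fin: "index k D \<noteq> \<infinity>" and "u \<in> vecs k" "D u = 0"
  shows "u = 0"
proof -
  obtain N where N: "index k D = enat N" using fin by auto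
  \<comment> \<open>\<open>N\<close> kills the cokernel and is -1 modulo \<open>p\<close>, so
    \<open>w\<close> is congruent to \<open>- N w\<close>, which lies in the image. This is the
    surjectivity modulo \<open>p\<close>.\<close>
  define p where "p = int N + 1"
  have p: "p > 1" using index_multiple(1)[OF N] by (simp add: p_def)
  define md where "md f = (\<lambda>i. f i mod p)" for f :: "nat \<Rightarrow> int"
  define dv where "dv f = (\<lambda>i. f i div p)" for f :: "nat \<Rightarrow> int"
  have split: "f = md f + scale p (dv f)" for f
    by (auto simp: md_def dv_def fun_eq_iff)
  have md_V: "md f \<in> vecs k" and dv_V: "dv f \<in> vecs k" if "f \<in> vecs k" for f
    using that by (auto simp: md_def dv_def vecs_def)
  have md_add: "md (f + scale p g) = md f" for f g
    by (auto simp: md_def fun_eq_iff)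
  have D_md: "md (D (md f)) = md (D f)" if "f \<in> vecs k" for f
  proof -
    have "D f = D (md f) + scale p (D (dv f))"
      using split[of f] md_V[OF that] dv_V[OF that] by (metis endo_add endo_scale vecs_closed(5))
    then show ?thesis by (simp add: md_add)
  qed
  define W where "W = md ` vecs k"
  have "W \<subseteq> {f. \<forall>i. (i \<in> {1..k} \<longrightarrow> f i \<in> {0..<p}) \<and> (i \<notin> {1..k} \<longrightarrow> f i = 0)}"
    using p by (auto simp: W_def md_def vecs_def)
  then have finW: "finite W"
    by (rule finite_subset) (intro finite_set_of_finite_funs; simp)
  have WV: "W \<subseteq> vecs k" using md_V by (auto simp: W_def)
  have md_W: "md w = w" if "w \<in> W" for w using that by (auto simp: W_def md_def)
  have "W \<subseteq> (\<lambda>w. md (D w)) ` W"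
  proof
    fix w assume w: "w \<in> W"
    obtain v where v: "v \<in> vecs k" "scale (int N) w = D v"
      using index_multiple(2)[OF N] w WV by blast
    have "md (D (md (- v))) = md (- D v)"
      using v D_md[of "- v"] by (simp add: endo_minus)
    moreover have "- D v = w + scale p (- w)"
      unfolding v(2)[symmetric] by (simp add: p_def fun_eq_iff algebra_simps)
    ultimately have "md (D (md (- v))) = w"
      using md_add[of w "- w"] md_W[OF w] by metis
    then show "w \<in> (\<lambda>w. md (D w)) ` W"
      using vecs_closed(4)[OF v(1)] unfolding W_def by (metis imageI)
  qed
  then have inj: "inj_on (\<lambda>w. md (D w)) W"
    using finite_surj_inj[OF finW] by blast
  have ker: "md f = 0" if "f \<in> vecs k" "D f = 0" for f
  proof -
    have zero: "md 0 = 0" by (simp add: md_def fun_eq_iff)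
    have "md (D (md f)) = md (D (md 0))"
      using D_md[OF that(1)] D_md[of 0] that by (simp add: endo_zero)
    moreover have "md f \<in> W" "md 0 \<in> W" using that(1) by (simp_all add: W_def)
    ultimately have "md f = md 0" by (rule inj_onD[OF inj])
    then show ?thesis by (simp add: zero)
  qed
  \<comment> \<open>A kernel vector divided by \<open>p\<close> is again a kernel vector, so the
    division can be repeated.\<close>
  have "p ^ j dvd f i" if "f \<in> vecs k" "D f = 0" for i j f
    using that
  proof (induction j arbitrary: f)
    case (Suc j)
    have f: "f = scale p (dv f)" using split[of f] ker[OF Suc.prems] by simp
    have "scale p (D (dv f)) = 0"
      using f Suc.prems dv_V endo_scale by metis
    then have "D (dv f) = 0" using p by (auto simp: fun_eq_iff)
    then have "p ^ j dvd dv f i" using Suc dv_V by blast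
    then have "p ^ Suc j dvd scale p (dv f) i" by simp
    then show ?case by (subst f)
  qed simp
  then have dvd: "p ^ j dvd u i" for i j using assms(2,3) by blast
  have "u i = 0" for i
  proof (rule ccontr)
    assume "u i \<noteq> 0"
    define j where "j = nat \<bar>u i\<bar>"
    have "p ^ j \<le> \<bar>u i\<bar>" using dvd[of j i] \<open>u i \<noteq> 0\<close> dvd_imp_le_int by force
    moreover have "int j < 2 ^ j" using less_exp[of j] by (metis of_nat_less_iff of_nat_power of_nat_numeral)
    moreover have "(2::int) ^ j \<le> p ^ j" using p by (intro power_mono) auto
    ultimately show False by (simp add: j_def)
  qed
  then show ?thesis by auto
qed

text \<open>If \<open>N = 2 m + 1\<close>, then \<open>v = N v - 2 m v\<close>. Conversely,
  surjectivity modulo 2 makes doubling onto, hence injective, on the finite cokernel; without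
  elements of order 2, negation pairs off the nonzero classes. The criterion sees \<open>D\<close>
  only modulo 2.\<close>

lemma odd_index_iff:
  assumes N: "index k D = enat N"
  shows "odd N \<longleftrightarrow> (\<forall>v\<in>vecs k. \<exists>a\<in>vecs k. \<exists>b\<in>vecs k. v = D a + scale 2 b)"
proof
  assume "odd N"
  then obtain m where m: "N = 2 * m + 1" by (rule oddE)
  show "\<forall>v\<in>vecs k. \<exists>a\<in>vecs k. \<exists>b\<in>vecs k. v = D a + scale 2 b"
  proof
    fix v assume v: "v \<in> vecs k"
    then obtain a where "a \<in> vecs k" "scale (int N) v = D a"
      using index_multiple(2)[OF N] by blast
    moreover have "v = scale (int N) v + scale 2 (scale (- int m) v)"
      by (simp add: m fun_eq_iff algebra_simps)
    ultimately show "\<exists>a\<in>vecs k. \<exists>b\<in>vecs k. v = D a + scale 2 b"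
      using v vecs_closed(5) by metis
  qed
next
  assume two: "\<forall>v\<in>vecs k. \<exists>a\<in>vecs k. \<exists>b\<in>vecs k. v = D a + scale 2 b"
  obtain T where T: "transversal (vecs k) (coset_rel k D) T"
    using transversal_exists[OF equiv_coset_rel] .
  have "ecard T = enat N"
    using ecard_quotient_transversal[OF equiv_coset_rel T] N by (simp add: index_def)
  then have fin: "finite T" and card: "card T = N"
    by (auto simp: ecard_def split: if_splits)
  obtain rep where rep: "rep ` vecs k = T"
    "\<And>u v. u \<in> vecs k \<Longrightarrow> v \<in> vecs k \<Longrightarrow> (u, v) \<in> coset_rel k D \<longleftrightarrow> rep u = rep v"
    "\<And>t. t \<in> T \<Longrightarrow> rep t = t"
    using transversal_rep[OF equiv_coset_rel T] by metis
  have TV: "t \<in> vecs k" if "t \<in> T" for t using T that by (auto simp: transversal_def)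
  have eq: "rep u = rep v \<longleftrightarrow> u - v \<in> D ` vecs k" if "u \<in> vecs k" "v \<in> vecs k" for u v
    using rep(2)[OF that] that by simp
  have rep_T: "rep u \<in> T" if "u \<in> vecs k" for u using rep(1) that by blast
  have rep_V: "rep u \<in> vecs k" if "u \<in> vecs k" for u using rep_T TV that by blast
  have rep_diff: "rep u - u \<in> D ` vecs k" if "u \<in> vecs k" for u
    using eq[OF rep_V[OF that] that] rep(3)[OF rep_T[OF that]] by simp
  have "T \<subseteq> (\<lambda>t. rep (scale 2 t)) ` T"
  proof
    fix t assume t: "t \<in> T"
    then obtain a b where ab: "a \<in> vecs k" "b \<in> vecs k" "t = D a + scale 2 b"
      using two TV by blast
    have "scale 2 (rep b) - t = scale 2 (rep b - b) - D a"
      using ab by (simp add: scale_distribs)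
    moreover have "scale 2 (rep b - b) \<in> D ` vecs k"
      using image_add[OF rep_diff[OF ab(2)] rep_diff[OF ab(2)]]
      by (simp add: scale_def fun_eq_iff algebra_simps plus_fun_def fun_diff_def)
    ultimately have "scale 2 (rep b) - t \<in> D ` vecs k"
      using image_diff[OF _ imageI[OF ab(1)]] by simp
    then have "rep (scale 2 (rep b)) = rep t"
      using ab t TV rep_V eq by simp
    then show "t \<in> (\<lambda>t. rep (scale 2 t)) ` T"
      using t rep(3) rep_T[OF ab(2)] by (metis imageI)
  qed
  then have inj: "inj_on (\<lambda>t. rep (scale 2 t)) T"
    using finite_surj_inj[OF fin] by blast
  \<comment> \<open>An arbitrary transversal need not contain 0, so \<open>rep 0\<close> stands for
    the zero class and is the one representative fixed by negation.\<close>
  let ?o = "rep 0" and ?\<iota> = "\<lambda>t. rep (- t)"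
  have o: "?o \<in> T" by (simp add: rep_T)
  have \<iota>\<iota>: "?\<iota> (?\<iota> t) = t" if "t \<in> T" for t
  proof -
    have "- ?\<iota> t - t \<in> D ` vecs k"
      using image_minus[OF rep_diff[of "- t"]] TV[OF that] by simp
    then show ?thesis using eq[of "- ?\<iota> t" t] TV[OF that] rep_V rep(3)[OF that] by simp
  qed
  have "even (card (T - {?o}))"
  proof (rule even_card_involution[where f = ?\<iota>])
    fix t assume "t \<in> T - {?o}"
    then have t: "t \<in> T" "t \<noteq> ?o" and tV: "t \<in> vecs k" using TV by auto
    show "?\<iota> (?\<iota> t) = t" using \<iota>\<iota> t by blast
    have "?\<iota> t \<noteq> ?o"
    proof
      assume "?\<iota> t = ?o"
      then have "- t \<in> D ` vecs k" using eq[of "- t" 0] tV by simp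
      then have "rep t = ?o" using image_minus[of "- t"] eq[of t 0] tV by simp
      with t rep(3) show False by simp
    qed
    then show "?\<iota> t \<in> T - {?o}" using rep_T tV by simp
    show "?\<iota> t \<noteq> t"
    proof
      assume "?\<iota> t = t"
      then have "t - (- t) \<in> D ` vecs k" using eq[of t "- t"] rep(3)[OF t(1)] tV by simp
      moreover have "t - (- t) = scale 2 t" by (simp add: fun_eq_iff)
      ultimately have "rep (scale 2 t) = rep 0" using eq[of "scale 2 t" 0] tV by simp
      moreover have "scale 2 ?o - 0 = ?o - 0 + (?o - 0)" by (simp add: fun_eq_iff)
      then have "rep (scale 2 ?o) = rep 0"
        using image_add[OF rep_diff[of 0] rep_diff[of 0]] eq[of "scale 2 ?o" 0] rep_V[of 0]
        by (metis vecs_closed(1,5))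
      ultimately show False using inj_onD[OF inj _ t(1) o] t(2) by simp
    qed
  qed (use fin in simp)
  moreover have "card T = Suc (card (T - {?o}))"
    using fin o by (metis card_Suc_Diff1)
  ultimately show "odd N" using card by simp
qed

text \<open>The image is the preimage of the multiples of \<open>m\<close> under the surjection
  \<open>\<sigma>\<close>, so the cokernel is the group of integers modulo \<open>m\<close>.\<close>

lemma index_functional:
  assumes \<sigma>: "\<And>u v. u \<in> vecs k \<Longrightarrow> v \<in> vecs k \<Longrightarrow> \<sigma> (u - v) = \<sigma> u - \<sigma> v"
    and onto: "\<sigma> ` vecs k = UNIV"
    and image: "\<And>g. g \<in> vecs k \<Longrightarrow> g \<in> D ` vecs k \<longleftrightarrow> m dvd \<sigma> g"
  shows "index k D = iabs m"
proof -
  have "index k D = ecard ((\<lambda>g. \<sigma> g mod \<bar>m\<bar>) ` vecs k)"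
    unfolding index_def using equiv_coset_rel
    by (rule ecard_quotient_eq_image) (simp add: image \<sigma> mod_eq_dvd_iff)
  also have "(\<lambda>g. \<sigma> g mod \<bar>m\<bar>) ` vecs k = range (\<lambda>j. j mod \<bar>m\<bar>)"
    by (simp only: onto[symmetric] image_image)
  finally show ?thesis by (simp add: ecard_range_mod)
qed

end

lemma iabs_mult: "iabs a * iabs b = iabs (a * b)"
  by (auto simp: iabs_def abs_mult nat_mult_distrib enat_0_iff)

lemma iabs_minus [simp]: "iabs (- a) = iabs a"
  by (simp add: iabs_def)

section \<open>The index of an integer 2 by 2 matrix\<close>

definition mat2 :: "int \<Rightarrow> int \<Rightarrow> int \<Rightarrow> int \<Rightarrow> (nat \<Rightarrow> int) \<Rightarrow> nat \<Rightarrow> int" where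
  "mat2 a b c d f = (\<lambda>i. if i = 1 then a * f 1 + b * f 2 else if i = 2 then c * f 1 + d * f 2 else 0)"

lemma vecs_2_iff: "f \<in> vecs 2 \<longleftrightarrow> (\<forall>i. i \<noteq> 1 \<and> i \<noteq> 2 \<longrightarrow> f i = 0)"
  by (auto simp: vecs_def)

lemma vecs_2_eqI:
  assumes "f \<in> vecs 2" "g \<in> vecs 2" "f 1 = g 1" "f 2 = g 2"
  shows "f = g"
  using assms unfolding vecs_2_iff by (metis ext)

lemma vec2_exists: "\<exists>f\<in>vecs 2. f 1 = x \<and> f 2 = (y :: int)"
  by (rule bexI[of _ "\<lambda>i. if i = 1 then x else if i = 2 then y else 0"]) (auto simp: vecs_2_iff)

lemma mat2_closed: "mat2 a b c d f \<in> vecs 2"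
  by (simp add: vecs_2_iff mat2_def)

lemma endo_mat2: "endo 2 (mat2 a b c d)"
  unfolding endo_def by (auto simp: mat2_closed) (auto simp: mat2_def fun_eq_iff algebra_simps)

text \<open>Column reduction: in the basis \<open>(x0, y0)\<close>, \<open>(d', - c')\<close> of the
  source the matrix is triangular, with columns \<open>(a x0 + b y0, g)\<close> and
  \<open>(a d' - b c', 0)\<close>. Membership is then solved from the second row upwards.\<close>

lemma mat2_image_iff:
  assumes w: "w \<in> vecs 2" and g: "c = g * c'" "d = g * d'" and bez: "c' * x0 + d' * y0 = 1"
  shows "w \<in> mat2 a b c d ` vecs 2 \<longleftrightarrow>
    (\<exists>q. w 2 = g * q \<and> a * d' - b * c' dvd w 1 - q * (a * x0 + b * y0))"
proof
  assume "w \<in> mat2 a b c d ` vecs 2"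
  then obtain f where f: "w = mat2 a b c d f" by auto
  have "w 2 = g * (c' * f 1 + d' * f 2)"
    by (simp add: f mat2_def g algebra_simps)
  moreover have "a * f 1 + b * f 2 - (c' * f 1 + d' * f 2) * (a * x0 + b * y0) =
      (a * d' - b * c') * (f 1 * y0 - f 2 * x0)"
    using bez by algebra
  then have "a * d' - b * c' dvd w 1 - (c' * f 1 + d' * f 2) * (a * x0 + b * y0)"
    by (simp add: f mat2_def)
  ultimately show "\<exists>q. w 2 = g * q \<and> a * d' - b * c' dvd w 1 - q * (a * x0 + b * y0)"
    by blast
next
  assume "\<exists>q. w 2 = g * q \<and> a * d' - b * c' dvd w 1 - q * (a * x0 + b * y0)"
  then obtain q t where q: "w 2 = g * q" and t: "w 1 - q * (a * x0 + b * y0) = (a * d' - b * c') * t"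
    by (auto elim!: dvdE)
  obtain f where f: "f \<in> vecs 2" "f 1 = q * x0 + d' * t" "f 2 = q * y0 - c' * t"
    using vec2_exists by blast
  have "w = mat2 a b c d f"
  proof (rule vecs_2_eqI[OF w mat2_closed])
    have "w 1 = a * (q * x0 + d' * t) + b * (q * y0 - c' * t)" using t by algebra
    then show "w 1 = mat2 a b c d f 1" using f(2,3) by (simp add: mat2_def)
    have "w 2 = c * (q * x0 + d' * t) + d * (q * y0 - c' * t)" using q g bez by algebra
    then show "w 2 = mat2 a b c d f 2" using f(2,3) by (simp add: mat2_def)
  qed
  then show "w \<in> mat2 a b c d ` vecs 2" using f by blast
qed

text \<open>In the triangular form, \<open>v 2\<close> modulo \<open>g\<close> together with the
  corrected first entry modulo \<open>h\<close> is a complete invariant, and \<open>g h\<close> is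
  the determinant.\<close>

lemma index_mat2: "index 2 (mat2 a b c d) = iabs (a * d - b * c)"
proof (cases "c = 0 \<and> d = 0")
  case True
  \<comment> \<open>A zero second row has gcd 0 and admits no Bezout normalisation; here distinct
    multiples of \<open>unit_vec 2\<close> lie in distinct classes.\<close>
  let ?S = "range (\<lambda>j. scale j (unit_vec 2))"
  have "inj (\<lambda>j. scale j (unit_vec 2))"
    by (rule injI) (auto simp: scale_def unit_vec_def fun_eq_iff split: if_splits)
  then have inf: "infinite ?S" by (simp add: finite_image_iff infinite_UNIV_int)
  have "index 2 (mat2 a b c d) = \<infinity>"
    unfolding index_def
  proof (rule infinite_quotient[OF equiv_coset_rel[OF endo_mat2] _ inf])
    show "?S \<subseteq> vecs 2" by auto
    fix x y assume "x \<in> ?S" "y \<in> ?S" and xy: "(x, y) \<in> coset_rel 2 (mat2 a b c d)"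
    then obtain i j where "x = scale i (unit_vec 2)" "y = scale j (unit_vec 2)" by auto
    moreover from xy obtain f where "x - y = mat2 a b c d f" by auto
    then have "(x - y) 2 = 0" using True by (simp add: mat2_def)
    ultimately show "x = y" by (simp add: unit_vec_def)
  qed
  then show ?thesis using True by (simp add: iabs_def)
next
  case False
  define g where "g = gcd c d"
  have g: "g > 0" using False by (auto simp: g_def)
  obtain c' d' where cd: "c = g * c'" "d = g * d'"
    by (metis g_def gcd_dvd1 gcd_dvd2 dvdE)
  obtain x0 y0 where "x0 * c + y0 * d = g" using bezout_int g_def by metis
  then have "g * (c' * x0 + d' * y0) = g * 1" by (simp add: cd algebra_simps)
  then have bez: "c' * x0 + d' * y0 = 1" using g by simp
  define h where "h = a * d' - b * c'"
  define r where "r = a * x0 + b * y0"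
  define f where "f v = ((v 1 - (v 2 div g) * r) mod \<bar>h\<bar>, v 2 mod \<bar>g\<bar>)" for v :: "nat \<Rightarrow> int"
  have "(u, v) \<in> coset_rel 2 (mat2 a b c d) \<longleftrightarrow> f u = f v" if uv: "u \<in> vecs 2" "v \<in> vecs 2" for u v
  proof -
    have "(\<exists>q. (u - v) 2 = g * q \<and> h dvd (u - v) 1 - q * r) \<longleftrightarrow> f u = f v"
    proof (cases "u 2 mod g = v 2 mod g")
      case True
      let ?q = "u 2 div g - v 2 div g"
      have "u 2 - v 2 = g * ?q"
        using True mult_div_mod_eq[of g "u 2"] mult_div_mod_eq[of g "v 2"]
        unfolding right_diff_distrib by linarith
      then have "u 2 - v 2 = g * q \<longleftrightarrow> q = ?q" for q using g by auto
      moreover have "f u = f v \<longleftrightarrow> h dvd (u 1 - v 1) - ?q * r"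
        using True g by (simp add: f_def mod_eq_dvd_iff algebra_simps)
      ultimately show ?thesis by simp
    next
      case False
      then have "\<not> g dvd u 2 - v 2" by (simp add: mod_eq_dvd_iff)
      then show ?thesis using False g by (auto simp: f_def)
    qed
    then show ?thesis
      using uv mat2_image_iff[OF _ cd bez, of "u - v" a b] by (simp add: h_def r_def)
  qed
  then have "index 2 (mat2 a b c d) = ecard (f ` vecs 2)"
    unfolding index_def using equiv_coset_rel[OF endo_mat2] by (intro ecard_quotient_eq_image)
  also have "f ` vecs 2 = range (\<lambda>j. j mod \<bar>h\<bar>) \<times> range (\<lambda>j. j mod \<bar>g\<bar>)"
  proof
    show "range (\<lambda>j. j mod \<bar>h\<bar>) \<times> range (\<lambda>j. j mod \<bar>g\<bar>) \<subseteq> f ` vecs 2"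
    proof clarify
      fix i j :: int
      obtain v where "v \<in> vecs 2" "v 1 = i + (j div g) * r" "v 2 = j"
        using vec2_exists by blast
      then show "(i mod \<bar>h\<bar>, j mod \<bar>g\<bar>) \<in> f ` vecs 2"
        by (intro image_eqI[of _ _ v]) (auto simp: f_def)
    qed
  qed (auto simp: f_def)
  also have "ecard \<dots> = iabs h * iabs g"
    by (simp add: ecard_Times ecard_range_mod)
  also have "\<dots> = iabs (a * d - b * c)"
    unfolding iabs_mult by (simp add: h_def cd algebra_simps)
  finally show ?thesis .
qed

text \<open>The companion matrix of \<open>x\<^sup>k + c\<^sub>k x\<^sup>k\<^sup>-\<^sup>1 + \<dots> + c\<^sub>1\<close>.\<close>

definition companion :: "nat \<Rightarrow> (nat \<Rightarrow> int) \<Rightarrow> (nat \<Rightarrow> int) \<Rightarrow> nat \<Rightarrow> int" where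
  "companion k c f = (\<lambda>i. if i \<in> {1..k} then f (i - 1) - c i * f k else 0)"

lemma companion_closed [simp]: "companion k c f \<in> vecs k"
  by (auto simp: companion_def vecs_def)

lemma endo_companion: "endo k (companion k c)"
  by (auto simp: endo_def simp del: atLeastAtMost_iff) (auto simp: companion_def fun_eq_iff algebra_simps)

lemma bij_companion:
  assumes "k \<ge> 1" "c 1 = 1"
  shows "bij_betw (companion k c) (vecs k) (vecs k)"
proof (rule bij_betwI)
  \<comment> \<open>The inverse solves the rows for \<open>f\<close>: the first reads
    \<open>g 1 = - f k\<close>, because \<open>f 0 = 0\<close> and \<open>c 1 = 1\<close>, and row
    \<open>i + 1\<close> then gives \<open>f i\<close>.\<close>
  let ?q = "\<lambda>g i. if i \<in> {1..k} then (if i = k then - g 1 else g (i + 1) - c (i + 1) * g 1) else (0 :: int)"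
  show "companion k c \<in> vecs k \<rightarrow> vecs k" by simp
  show "?q \<in> vecs k \<rightarrow> vecs k" by (auto simp: vecs_def)
  show "?q (companion k c f) = f" if "f \<in> vecs k" for f
    using that assms by (auto simp: companion_def vecs_def fun_eq_iff)
  show "companion k c (?q g) = g" if "g \<in> vecs k" for g
  proof
    fix i
    show "companion k c (?q g) i = g i"
    proof (cases i)
      case (Suc j)
      then show ?thesis
        using that assms by (cases j) (auto simp: companion_def vecs_def)
    qed (use that in \<open>auto simp: companion_def vecs_def\<close>)
  qed
qed

lemma endo_fun_add: "endo k P \<Longrightarrow> endo k Q \<Longrightarrow> endo k (\<lambda>u. P u + Q u)"
  and endo_fun_diff: "endo k P \<Longrightarrow> endo k Q \<Longrightarrow> endo k (\<lambda>u. P u - Q u)"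
  and endo_id: "endo k (\<lambda>u. u)"
  by (auto simp: endo_def image_subset_iff)

text \<open>Adding all rows telescopes: the coordinate sum of \<open>f - companion k c f\<close> is
  \<open>f k\<close> times the value of the characteristic polynomial at 1.\<close>

lemma image_id_minus_companion:
  assumes k: "k \<ge> 1" and g: "g \<in> vecs k"
  shows "g \<in> (\<lambda>f. f - companion k c f) ` vecs k \<longleftrightarrow> 1 + (\<Sum>i=1..k. c i) dvd (\<Sum>i=1..k. g i)"
proof
  assume "g \<in> (\<lambda>f. f - companion k c f) ` vecs k"
  then obtain f where f: "f \<in> vecs k" "g = f - companion k c f" by auto
  have "(\<Sum>i=1..k. g i) = (\<Sum>i=1..k. (f i - f (i - 1)) + c i * f k)"
    by (rule sum.cong) (auto simp: f companion_def)
  also have "\<dots> = (\<Sum>i\<in>{Suc 0..k}. f i - f (i - 1)) + (\<Sum>i=1..k. c i) * f k"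
    by (simp add: sum.distrib sum_distrib_right)
  also have "(\<Sum>i\<in>{Suc 0..k}. f i - f (i - 1)) = f k - f 0"
    using k by (intro sum_telescope'') simp
  also have "f 0 = 0" using f by (simp add: vecs_def)
  finally have "(\<Sum>i=1..k. g i) = (1 + (\<Sum>i=1..k. c i)) * f k" by (simp add: algebra_simps)
  then show "1 + (\<Sum>i=1..k. c i) dvd (\<Sum>i=1..k. g i)" by simp
next
  assume "1 + (\<Sum>i=1..k. c i) dvd (\<Sum>i=1..k. g i)"
  then obtain h where h: "(\<Sum>i=1..k. g i) = (1 + (\<Sum>i=1..k. c i)) * h" by (rule dvdE)
  \<comment> \<open>With \<open>h\<close> as the intended \<open>f k\<close>, row \<open>i\<close>
    demands \<open>f i - f (i - 1) = g i - c i * h\<close>, so \<open>f\<close> has to be the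
    partial sums; divisibility makes the last one equal to \<open>h\<close>.\<close>
  define f where "f i = (if i \<in> {1..k} then \<Sum>j=1..i. g j - c j * h else 0)" for i
  have "f \<in> vecs k" by (simp add: f_def vecs_def)
  have "(\<Sum>i=1..k. c i * h) = (\<Sum>i=1..k. c i) * h"
    by (simp only: sum_distrib_right)
  then have fk: "f k = h"
    using k h by (simp add: f_def sum_subtractf distrib_right)
  have "g = f - companion k c f"
  proof
    fix i
    show "g i = (f - companion k c f) i"
    proof (cases "i \<in> {1..k}")
      case True
      then obtain j where j: "i = Suc j" by (cases i) auto
      have "f i - f j = g i - c i * h"
        using True by (auto simp: f_def j)
      then show ?thesis using True fk by (simp add: companion_def j)
    next
      case False
      then show ?thesis using g \<open>f \<in> vecs k\<close> by (auto simp: companion_def vecs_def)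
    qed
  qed
  with \<open>f \<in> vecs k\<close> show "g \<in> (\<lambda>f. f - companion k c f) ` vecs k" by blast
qed

lemma index_id_minus_companion:
  assumes "k \<ge> 1"
  shows "index k (\<lambda>f. f - companion k c f) = iabs (1 + (\<Sum>i=1..k. c i))"
proof (rule index_functional[OF endo_fun_diff[OF endo_id endo_companion]])
  show "(\<lambda>g. \<Sum>i=1..k. g i) ` vecs k = UNIV"
  proof -
    have "j = (\<Sum>i=1..k. scale j (unit_vec 1) i)" for j
      using assms by (simp add: unit_vec_def sum.delta' flip: sum_distrib_left)
    then show ?thesis using assms by (metis (no_types, lifting) UNIV_eq_I atLeastAtMost_iff imageI order_refl unit_vec_vecs vecs_closed(5))
  qed
qed (use assms in \<open>simp_all add: sum_subtractf image_id_minus_companion\<close>)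

text \<open>Conjugating by \<open>f i \<mapsto> (-1)\<^sup>i f i\<close> turns the companion matrix \<open>P\<close> into minus a companion
  matrix, so \<open>I + P\<close> reduces to the previous case.\<close>

lemma index_id_plus_companion:
  assumes "k \<ge> 1"
  shows "index k (\<lambda>f. f + companion k c f) = iabs (1 - (\<Sum>i=1..k. (-1) ^ (i + k) * c i))"
proof (rule index_functional[OF endo_fun_add[OF endo_id endo_companion]])
  \<comment> \<open>Replacing \<open>P\<close> by \<open>- P\<close> substitutes \<open>- x\<close>
    in the characteristic polynomial; the factor \<open>(-1) ^ k\<close> makes it monic
    again.\<close>
  let ?c = "\<lambda>i. - ((-1) ^ (i + k) * c i)"
  define e :: "(nat \<Rightarrow> int) \<Rightarrow> nat \<Rightarrow> int" where "e f = (\<lambda>i. (-1) ^ i * f i)" for f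
  have ee: "e (e f) = f" for f by (simp add: e_def fun_eq_iff flip: mult.assoc power_add)
  have eV: "e f \<in> vecs k" if "f \<in> vecs k" for f using that by (auto simp: e_def vecs_def)
  have conj: "f + companion k c f = e (e f - companion k ?c (e f))" for f
  proof
    fix i
    show "(f + companion k c f) i = e (e f - companion k ?c (e f)) i"
      by (cases i) (auto simp: e_def companion_def algebra_simps power_add simp flip: power_mult_distrib)
  qed
  have image: "g \<in> (\<lambda>f. f + companion k c f) ` vecs k \<longleftrightarrow> e g \<in> (\<lambda>f. f - companion k ?c f) ` vecs k" for g
    unfolding conj using ee eV by (smt (verit, best) image_iff)
  show "g \<in> (\<lambda>f. f + companion k c f) ` vecs k \<longleftrightarrow>
      1 - (\<Sum>i=1..k. (-1) ^ (i + k) * c i) dvd (\<Sum>i=1..k. e g i)" if "g \<in> vecs k" for g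
    unfolding image image_id_minus_companion[OF assms eV[OF that]] by (simp add: sum_negf)
  show "(\<Sum>i=1..k. e (u - v) i) = (\<Sum>i=1..k. e u i) - (\<Sum>i=1..k. e v i)" for u v
    by (simp add: e_def algebra_simps sum_subtractf)
  show "(\<lambda>g. \<Sum>i=1..k. e g i) ` vecs k = UNIV"
  proof -
    have "j = (\<Sum>i=1..k. e (e (scale j (unit_vec 1))) i)" for j
      using assms by (simp add: ee unit_vec_def sum.delta' flip: sum_distrib_left)
    moreover have "e (scale j (unit_vec 1)) \<in> vecs k" for j using assms by (intro eV) simp
    ultimately show ?thesis by (metis (no_types, lifting) UNIV_eq_I imageI)
  qed
qed

section \<open>Automorphisms of the model\<close>

lemma additive_int_scale:
  fixes g :: "int \<Rightarrow> nat \<Rightarrow> int"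
  assumes add: "\<And>a b. g (a + b) = g a + g b"
  shows "g s = scale s (g 1)"
proof -
  have zero: "g 0 = 0" using add[of 0 0] by simp
  have nat: "g (int n) = scale (int n) (g 1)" for n
    by (induction n) (simp_all add: zero add scale_distribs)
  have neg: "g (- s) = - g s"
    using add[of s "- s"] zero by (simp add: eq_neg_iff_add_eq_0 add.commute)
  show ?thesis
  proof (cases "s \<ge> 0")
    case True
    then show ?thesis using nat[of "nat s"] by simp
  next
    case False
    then show ?thesis using nat[of "nat (- s)"] neg by simp
  qed
qed

lemma heis_commute_iff:
  "(u, s, z) \<otimes>\<^bsub>heis k\<^esub> (u', s', z') = (u', s', z') \<otimes>\<^bsub>heis k\<^esub> (u, s, z) \<longleftrightarrow> scale s u' = scale s' u"
  by (auto simp: algebra_simps)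

lemma scale_eq_0_iff [simp]: "scale m u = 0 \<longleftrightarrow> m = 0 \<or> u = 0"
  by (auto simp: fun_eq_iff)

text \<open>Two test elements suffice: \<open>(0, 1, 0)\<close> detects \<open>u\<close> and
  \<open>(unit_vec 1, 0, 0)\<close> detects \<open>s\<close>.\<close>

lemma heis_central:
  assumes "k \<ge> 1" "(u, s, z) \<in> carrier (heis k)"
    and "\<And>d. d \<in> carrier (heis k) \<Longrightarrow> (u, s, z) \<otimes>\<^bsub>heis k\<^esub> d = d \<otimes>\<^bsub>heis k\<^esub> (u, s, z)"
  shows "u = 0" "s = 0"
proof -
  show "u = 0" using assms(3)[of "(0, 1, 0)"] heis_commute_iff[of k u s z 0 1 0] by simp
  have "scale s (unit_vec 1) = scale 0 u"
    using assms(1) assms(3)[of "(unit_vec 1, 0, 0)"] heis_commute_iff[of k u s z "unit_vec 1" 0 0]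
    by simp
  then show "s = 0" by (auto simp: fun_eq_iff unit_vec_def split: if_splits)
qed

text \<open>The images of \<open>(u, 0, 0)\<close> and \<open>(0, 1, 0)\<close> decide everything
  but \<open>q\<close>, since the elements \<open>(0, 0, z)\<close> are commutators of these.
  \<open>q\<close> stays unspecified: only its closure and the consequence \<open>q 0 0 = 0\<close>
  enter the count.\<close>

lemma heis_iso_structure:
  assumes k: "k \<ge> 2" and \<phi>: "\<phi> \<in> iso (heis k) (heis k)"
  obtains P w \<epsilon> q where "endo k P" "bij_betw P (vecs k) (vecs k)" "w \<in> vecs k" "\<epsilon> = 1 \<or> \<epsilon> = - 1"
    "\<And>u s. u \<in> vecs k \<Longrightarrow> q u s \<in> vecs k"
    "\<And>u s z. u \<in> vecs k \<Longrightarrow> z \<in> vecs k \<Longrightarrow>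
      \<phi> (u, s, z) = (P u + scale s w, \<epsilon> * s, q u s + scale \<epsilon> (P z))"
proof -
  let ?H = "heis k"
  have hom: "\<phi> \<in> hom ?H ?H" and surj: "\<phi> ` carrier ?H = carrier ?H" and inj: "inj_on \<phi> (carrier ?H)"
    using \<phi> by (auto simp: iso_iff)
  define U where "U c = fst (\<phi> c)" for c
  define S where "S c = fst (snd (\<phi> c))" for c
  define Z where "Z c = snd (snd (\<phi> c))" for c
  have \<phi>_eq: "\<phi> c = (U c, S c, Z c)" for c by (simp add: U_def S_def Z_def)
  have closed: "U c \<in> vecs k" "Z c \<in> vecs k" if "c \<in> carrier ?H" for c
    using hom_in_carrier[OF hom that] by (auto simp: \<phi>_eq)
  have mult: "U (c \<otimes>\<^bsub>?H\<^esub> d) = U c + U d" "S (c \<otimes>\<^bsub>?H\<^esub> d) = S c + S d"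
    "Z (c \<otimes>\<^bsub>?H\<^esub> d) = Z c + Z d + scale (S c) (U d)"
    if "c \<in> carrier ?H" "d \<in> carrier ?H" for c d
    using hom_mult[OF hom that] by (simp_all add: \<phi>_eq)
  \<comment> \<open>If the first two parts of the image of \<open>(u, 0, 0)\<close> vanish, the
    image is central, and injectivity pulls centrality back to \<open>(u, 0, 0)\<close>.\<close>
  have trivial: "u = 0" if "u \<in> vecs k" "U (u, 0, 0) = 0" "S (u, 0, 0) = 0" for u
  proof (rule heis_central(1))
    show "(u, 0, 0) \<in> carrier ?H" using that by simp
    fix d assume d: "d \<in> carrier ?H"
    have "\<phi> (u, 0, 0) \<otimes>\<^bsub>?H\<^esub> \<phi> d = \<phi> d \<otimes>\<^bsub>?H\<^esub> \<phi> (u, 0, 0)"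
      by (simp add: \<phi>_eq that)
    then have "\<phi> ((u, 0, 0) \<otimes>\<^bsub>?H\<^esub> d) = \<phi> (d \<otimes>\<^bsub>?H\<^esub> (u, 0, 0))"
      using hom_mult[OF hom] d that by simp
    then show "(u, 0, 0) \<otimes>\<^bsub>?H\<^esub> d = d \<otimes>\<^bsub>?H\<^esub> (u, 0, 0)"
      by (rule inj_onD[OF inj]) (use d that in \<open>simp_all del: heis_simps(2)\<close>)
  qed (use k in simp)
  define \<sigma> where "\<sigma> u = S (u, 0, 0)" for u
  have \<sigma>_add: "\<sigma> (u + v) = \<sigma> u + \<sigma> v" if "u \<in> vecs k" "v \<in> vecs k" for u v
    using mult(2)[of "(u, 0, 0)" "(v, 0, 0)"] that by (simp add: \<sigma>_def)
  \<comment> \<open>Multiplication by a fixed unit vector turns the integer-valued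
    \<open>\<sigma>\<close> into an endomorphism, so that \<open>endo_scale\<close> yields its
    homogeneity.\<close>
  have \<sigma>_endo: "endo k (\<lambda>u. scale (\<sigma> u) (unit_vec 1))"
    using k by (auto simp: endo_def \<sigma>_add scale_distribs)
  have \<sigma>_scale: "\<sigma> (scale m u) = m * \<sigma> u" if "u \<in> vecs k" for m u
    using fun_cong[OF endo_scale[OF \<sigma>_endo that, of m], of 1] by (simp add: unit_vec_def)
  text \<open>The abelian subgroup \<open>s = 0\<close> is characteristic: as its rank is at least 2, it contains
    \<open>u\<^sub>1 \<noteq> 0\<close> with \<open>\<sigma> u\<^sub>1 = 0\<close>, and commuting with an element outside the subgroup
    forces the image of \<open>u\<^sub>1\<close> to be central.\<close>
  have \<sigma>0: "\<sigma> u0 = 0" if u0: "u0 \<in> vecs k" for u0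
  proof (rule ccontr)
    assume "\<sigma> u0 \<noteq> 0"
    let ?a = "unit_vec 1" and ?b = "unit_vec 2"
    have ab: "?a \<in> vecs k" "?b \<in> vecs k" using k by auto
    obtain u1 where u1: "u1 \<in> vecs k" "u1 \<noteq> 0" "\<sigma> u1 = 0"
    proof (cases "\<sigma> ?a = 0")
      case True
      moreover have "?a 1 \<noteq> 0 1" by (simp add: unit_vec_def)
      ultimately show ?thesis using that[of ?a] ab by metis
    next
      case False
      let ?u = "scale (\<sigma> ?b) ?a + scale (- \<sigma> ?a) ?b"
      have "?u 2 \<noteq> 0 2" using False by (simp add: unit_vec_def)
      moreover have "\<sigma> ?u = 0"
        using ab by (simp only: \<sigma>_add \<sigma>_scale vecs_closed) simp
      moreover have "?u \<in> vecs k" using ab by (intro vecs_closed)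
      ultimately show ?thesis using that[of ?u] by metis
    qed
    have "\<phi> (u0, 0, 0) \<otimes>\<^bsub>?H\<^esub> \<phi> (u1, 0, 0) = \<phi> (u1, 0, 0) \<otimes>\<^bsub>?H\<^esub> \<phi> (u0, 0, 0)"
      using hom_mult[OF hom, of "(u0, 0, 0)" "(u1, 0, 0)"] hom_mult[OF hom, of "(u1, 0, 0)" "(u0, 0, 0)"] u0 u1(1)
      by (simp add: add.commute)
    then have "scale (\<sigma> u0) (U (u1, 0, 0)) = scale (\<sigma> u1) (U (u0, 0, 0))"
      unfolding \<phi>_eq heis_commute_iff \<sigma>_def .
    then have "U (u1, 0, 0) = 0" using u1 \<open>\<sigma> u0 \<noteq> 0\<close> by simp
    then have "u1 = 0" using trivial u1 by (simp add: \<sigma>_def)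
    with u1 show False by simp
  qed
  define P where "P u = U (u, 0, 0)" for u
  define w where "w = U (0, 1, 0)"
  define \<epsilon> where "\<epsilon> = S (0, 1, 0)"
  have P_closed: "P u \<in> vecs k" if "u \<in> vecs k" for u
    using closed[of "(u, 0, 0)"] that by (simp add: P_def)
  have w_closed: "w \<in> vecs k" using closed[of "(0, 1, 0)"] by (simp add: w_def)
  have "P (u + v) = P u + P v" if "u \<in> vecs k" "v \<in> vecs k" for u v
    using mult(1)[of "(u, 0, 0)" "(v, 0, 0)"] that by (simp add: P_def)
  then have endo: "endo k P" using P_closed by (auto simp: endo_def)
  have \<phi>u: "\<phi> (u, 0, 0) = (P u, 0, Z (u, 0, 0))" if "u \<in> vecs k" for u
    using \<sigma>0[OF that] by (simp add: \<phi>_eq[of "(u, 0, 0)"] P_def \<sigma>_def)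
  have \<phi>z: "\<phi> (0, 0, z) = (0, 0, scale \<epsilon> (P z))" if z: "z \<in> vecs k" for z
  proof -
    \<comment> \<open>\<open>(0, 0, z)\<close> is the commutator of \<open>(0, 1, 0)\<close> and
      \<open>(z, 0, 0)\<close>; applying \<open>\<phi>\<close> to this relation and comparing
      coordinates determines its image.\<close>
    have "(0, 1, 0) \<otimes>\<^bsub>?H\<^esub> (z, 0, 0) = (0, 0, z) \<otimes>\<^bsub>?H\<^esub> (z, 0, 0) \<otimes>\<^bsub>?H\<^esub> (0, 1, 0)" by simp
    then have "\<phi> (0, 1, 0) \<otimes>\<^bsub>?H\<^esub> \<phi> (z, 0, 0) = \<phi> (0, 0, z) \<otimes>\<^bsub>?H\<^esub> \<phi> (z, 0, 0) \<otimes>\<^bsub>?H\<^esub> \<phi> (0, 1, 0)"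
      using hom_mult[OF hom] z by (metis heis.m_closed heis_simps(1) vecs_closed(1))
    then have "w + P z = U (0, 0, z) + P z + w" "\<epsilon> = S (0, 0, z) + \<epsilon>"
      "Z (0, 1, 0) + Z (z, 0, 0) + scale \<epsilon> (P z) = Z (0, 0, z) + Z (z, 0, 0) + scale (S (0, 0, z)) (P z)
        + Z (0, 1, 0) + scale (S (0, 0, z)) w"
      unfolding \<phi>u[OF z] \<phi>_eq[of "(0, 1, 0)"] \<phi>_eq[of "(0, 0, z)"]
      by (simp_all add: w_def[symmetric] \<epsilon>_def[symmetric])
    then have "U (0, 0, z) = 0" "S (0, 0, z) = 0" "Z (0, 0, z) = scale \<epsilon> (P z)"
      by (simp_all add: algebra_simps)
    then show ?thesis by (simp add: \<phi>_eq[of "(0, 0, z)"])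
  qed
  have \<phi>s: "U (0, s, 0) = scale s w" "S (0, s, 0) = \<epsilon> * s" for s
  proof -
    have add: "U (0, a + b, 0) = U (0, a, 0) + U (0, b, 0)" "S (0, a + b, 0) = S (0, a, 0) + S (0, b, 0)" for a b
      using mult(1,2)[of "(0, a, 0)" "(0, b, 0)"] by simp_all
    show "U (0, s, 0) = scale s w"
      unfolding w_def by (rule additive_int_scale) (rule add)
    \<comment> \<open>The integer is wrapped into a constant sequence so that
      \<open>additive_int_scale\<close> applies to it.\<close>
    have "(\<lambda>_::nat. S (0, s, 0)) = scale s (\<lambda>_. \<epsilon>)"
      unfolding \<epsilon>_def by (rule additive_int_scale) (simp only: add plus_fun_def)
    then show "S (0, s, 0) = \<epsilon> * s" by (simp add: fun_eq_iff)
  qed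
  define q where "q u s = Z (u, s, 0)" for u s
  have q_closed: "q u s \<in> vecs k" if "u \<in> vecs k" for u s
    using closed[of "(u, s, 0)"] that by (simp add: q_def)
  have shape: "\<phi> (u, s, z) = (P u + scale s w, \<epsilon> * s, q u s + scale \<epsilon> (P z))"
    if u: "u \<in> vecs k" and z: "z \<in> vecs k" for u s z
  proof -
    have "\<phi> ((u, 0, 0) \<otimes>\<^bsub>?H\<^esub> (0, s, 0)) = \<phi> (u, 0, 0) \<otimes>\<^bsub>?H\<^esub> \<phi> (0, s, 0)"
      using u by (intro hom_mult[OF hom]) auto
    then have us: "U (u, s, 0) = P u + scale s w" "S (u, s, 0) = \<epsilon> * s"
      by (simp_all add: \<phi>u[OF u] \<phi>_eq[of "(0, s, 0)"] \<phi>_eq[of "(u, s, 0)"] \<phi>s)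
    have "\<phi> ((u, s, 0) \<otimes>\<^bsub>?H\<^esub> (0, 0, z)) = \<phi> (u, s, 0) \<otimes>\<^bsub>?H\<^esub> \<phi> (0, 0, z)"
      using u z by (intro hom_mult[OF hom]) auto
    then show ?thesis
      by (simp add: \<phi>z[OF z] \<phi>_eq[of "(u, s, 0)"] us q_def)
  qed
  have \<epsilon>: "\<epsilon> = 1 \<or> \<epsilon> = - 1"
  proof -
    have "(0, 1, 0) \<in> \<phi> ` carrier ?H" using surj by simp
    then obtain u s z where "u \<in> vecs k" "z \<in> vecs k" "\<phi> (u, s, z) = (0, 1, 0)"
      by (auto simp: image_iff)
    then have "\<epsilon> * s = 1" using shape by simp
    then show ?thesis by (auto simp: zmult_eq_1_iff)
  qed
  have "bij_betw P (vecs k) (vecs k)"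
    unfolding bij_betw_def
  proof
    show "inj_on P (vecs k)"
    proof (rule inj_onI)
      fix u v assume uv: "u \<in> vecs k" "v \<in> vecs k" "P u = P v"
      then have "U (u - v, 0, 0) = 0" using endo_diff[OF endo, of u v] by (simp add: P_def)
      then have "u - v = 0"
        by (rule trivial[rotated]) (use uv \<sigma>0[of "u - v"] in \<open>auto simp: \<sigma>_def\<close>)
      then show "u = v" by simp
    qed
    show "P ` vecs k = vecs k"
    proof
      show "vecs k \<subseteq> P ` vecs k"
      proof
        fix v assume "v \<in> vecs k"
        then have "(v, 0, 0) \<in> \<phi> ` carrier ?H" using surj by simp
        then obtain c where c: "c \<in> carrier ?H" "\<phi> c = (v, 0, 0)" by (metis imageE)
        then obtain u s z where usz: "u \<in> vecs k" "z \<in> vecs k" "\<phi> (u, s, z) = (v, 0, 0)"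
          by (cases c) auto
        then have "s = 0" "v = P u" using shape \<epsilon> by auto
        then show "v \<in> P ` vecs k" using usz by blast
      qed
    qed (use P_closed in auto)
  qed
  from that[OF endo this w_closed \<epsilon> q_closed shape] show ?thesis .
qed

section \<open>Reidemeister numbers of the two kinds of automorphism\<close>

lemma heis_neg_iso:
  assumes P: "endo k P" "bij_betw P (vecs k) (vecs k)"
  shows "(\<lambda>(u, s, z). (P u, - s, - P z)) \<in> iso (heis k) (heis k)" (is "?\<phi> \<in> _")
  unfolding iso_iff
proof (intro conjI)
  show "?\<phi> \<in> hom (heis k) (heis k)"
  proof (rule homI)
    fix x y assume "x \<in> carrier (heis k)" "y \<in> carrier (heis k)"
    then show "?\<phi> (x \<otimes>\<^bsub>heis k\<^esub> y) = ?\<phi> x \<otimes>\<^bsub>heis k\<^esub> ?\<phi> y"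
      by (cases x; cases y) (simp add: endo_add[OF P(1)] endo_scale[OF P(1)])
  qed (use P(1) in auto)
  show "inj_on ?\<phi> (carrier (heis k))"
    using P(2) by (auto simp: inj_on_def bij_betw_def)
  show "?\<phi> ` carrier (heis k) = carrier (heis k)"
  proof
    show "carrier (heis k) \<subseteq> ?\<phi> ` carrier (heis k)"
    proof clarify
      fix u s z assume "(u, s, z) \<in> carrier (heis k)"
      then obtain v y where "v \<in> vecs k" "u = P v" "y \<in> vecs k" "z = - P y"
        using P(2) unfolding bij_betw_def by (metis heis_simps(1) imageE minus_minus vecs_closed(4))
      then show "(u, s, z) \<in> ?\<phi> ` carrier (heis k)"
        by (intro image_eqI[of _ _ "(v, - s, y)"]) auto
    qed
  qed (use P(1) in auto)
qed

lemma heis_reidemeister_pos: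
  assumes \<phi>: "\<phi> \<in> hom (heis k) (heis k)"
    and shape: "\<And>u s z. (u, s, z) \<in> carrier (heis k) \<Longrightarrow> fst (snd (\<phi> (u, s, z))) = s"
  shows "reidemeister (heis k) \<phi> = \<infinity>"
  unfolding reidemeister_ecard
proof (rule infinite_quotient[OF heis.equiv_twisted_conj[OF \<phi>], of "range (\<lambda>s. (0, s, 0))"])
  show "infinite (range (\<lambda>s::int. (0 :: nat \<Rightarrow> int, s, 0 :: nat \<Rightarrow> int)))"
    by (simp add: finite_image_iff inj_on_def infinite_UNIV_int)
  fix x y assume "x \<in> range (\<lambda>s::int. (0 :: nat \<Rightarrow> int, s, 0 :: nat \<Rightarrow> int))"
    "y \<in> range (\<lambda>s::int. (0 :: nat \<Rightarrow> int, s, 0 :: nat \<Rightarrow> int))"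
    and xy: "(x, y) \<in> twisted_conj (heis k) \<phi>"
  then obtain s s' where s: "x = (0, s, 0)" "y = (0, s', 0)" by auto
  with xy obtain c where c: "c \<in> carrier (heis k)" "(0, s, 0) \<otimes>\<^bsub>heis k\<^esub> \<phi> c = c \<otimes>\<^bsub>heis k\<^esub> (0, s', 0)"
    using heis.twisted_conj_iff[OF \<phi>, of x y] by auto
  obtain a m b where abm: "c = (a, m, b)" by (cases c)
  obtain a' m' b' where \<phi>c: "\<phi> c = (a', m', b')" by (cases "\<phi> c")
  have "m' = m" using shape[of a m b] c abm \<phi>c by simp
  then show "x = y" using c s abm \<phi>c by simp
qed auto

text \<open>For the conjugator \<open>(a, m, y)\<close>, \<open>m\<close> normalises
  \<open>s\<close>, then \<open>a\<close> normalises \<open>u\<close>, then \<open>y\<close>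
  normalises \<open>z\<close>. This order works because the mixed terms in each equation involve
  only choices already made.\<close>

lemma heis_reidemeister_neg:
  assumes \<phi>: "\<phi> \<in> hom (heis k) (heis k)" and P: "endo k P" and w: "w \<in> vecs k"
    and q: "\<And>u s. u \<in> vecs k \<Longrightarrow> q u s \<in> vecs k"
    and shape: "\<And>u s z. u \<in> vecs k \<Longrightarrow> z \<in> vecs k \<Longrightarrow>
      \<phi> (u, s, z) = (P u + scale s w, - s, q u s - P z)"
  shows "reidemeister (heis k) \<phi> = 2 * index k (\<lambda>u. u - P u) * index k (\<lambda>u. u + P u)"
proof -
  let ?R = "twisted_conj (heis k) \<phi>"
  let ?D1 = "\<lambda>u. u - P u" and ?D2 = "\<lambda>u. u + P u"
  note eqv = heis.equiv_twisted_conj[OF \<phi>]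
  have D1: "endo k ?D1" and D2: "endo k ?D2"
    using P by (auto simp: endo_def image_subset_iff)
  have tw: "((u, s, z), (u', s', z')) \<in> ?R \<longleftrightarrow> (\<exists>a\<in>vecs k. \<exists>m. \<exists>y\<in>vecs k.
      u + (P a + scale m w) = a + u' \<and> s - m = m + s' \<and>
      z + (q a m - P y) + scale s (P a + scale m w) = y + z' + scale m u')"
    if "u \<in> vecs k" "z \<in> vecs k" "u' \<in> vecs k" "z' \<in> vecs k" for u s z u' s' z'
  proof -
    have "((u, s, z), (u', s', z')) \<in> ?R \<longleftrightarrow> (\<exists>c\<in>carrier (heis k).
        (u, s, z) \<otimes>\<^bsub>heis k\<^esub> \<phi> c = c \<otimes>\<^bsub>heis k\<^esub> (u', s', z'))"
      using that by (intro heis.twisted_conj_iff[OF \<phi>]) auto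
    also have "\<dots> \<longleftrightarrow> (\<exists>a\<in>vecs k. \<exists>m. \<exists>y\<in>vecs k.
        (u, s, z) \<otimes>\<^bsub>heis k\<^esub> \<phi> (a, m, y) = (a, m, y) \<otimes>\<^bsub>heis k\<^esub> (u', s', z'))"
      by (auto simp: heis_def)
    finally show ?thesis by (simp add: shape cong: bex_cong)
  qed
  have q00: "q 0 0 = 0"
    using hom_one[OF \<phi> group_heis group_heis] shape[of 0 0 0] endo_zero[OF P] by simp
  obtain T1 where T1: "transversal (vecs k) (coset_rel k ?D1) T1"
    using transversal_exists[OF equiv_coset_rel[OF D1]] .
  obtain T2 where T2: "transversal (vecs k) (coset_rel k ?D2) T2"
    using transversal_exists[OF equiv_coset_rel[OF D2]] .
  have T1V: "u \<in> vecs k" if "u \<in> T1" for u using T1 that by (auto simp: transversal_def)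
  have T2V: "u \<in> vecs k" if "u \<in> T2" for u using T2 that by (auto simp: transversal_def)
  have uniq: "t = t'" if "transversal (vecs k) (coset_rel k D) T" "endo k D" "t \<in> T" "t' \<in> T" "t - t' \<in> D ` vecs k"
    for D T t t'
    using that image_zero[OF that(2)] unfolding transversal_def
    by (metis coset_rel_iff diff_self subsetD)
  have index1: "index k ?D1 = ecard T1"
    unfolding index_def by (rule ecard_quotient_transversal[OF equiv_coset_rel[OF D1] T1])
  have index2: "index k ?D2 = ecard T2"
    unfolding index_def by (rule ecard_quotient_transversal[OF equiv_coset_rel[OF D2] T2])
  have ne: "T1 \<noteq> {}" "T2 \<noteq> {}"
    using T1 T2 vecs_closed(1) unfolding transversal_def by (metis empty_iff)+
  show ?thesis
  proof (cases "index k ?D1 = \<infinity>")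
    case True
    then have inf: "infinite T1" using index1 by (auto simp: ecard_def)
    have "reidemeister (heis k) \<phi> = \<infinity>"
      unfolding reidemeister_ecard
    proof (rule infinite_quotient[OF eqv, of "(\<lambda>u. (u, 0, 0)) ` T1"])
      show "infinite ((\<lambda>u. (u, 0 :: int, 0 :: nat \<Rightarrow> int)) ` T1)"
        using inf by (simp add: finite_image_iff inj_on_def)
      fix x y assume "x \<in> (\<lambda>u. (u, 0, 0)) ` T1" "y \<in> (\<lambda>u. (u, 0, 0)) ` T1" and xy: "(x, y) \<in> ?R"
      then obtain u v where uv: "x = (u, 0, 0)" "y = (v, 0, 0)" "u \<in> T1" "v \<in> T1" by auto
      \<comment> \<open>Equal middle coordinates force \<open>m = 0\<close>, which removes
        \<open>w\<close>.\<close>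
      with xy obtain a where "a \<in> vecs k" "u + P a = a + v"
        using tw[of u 0 v 0 0 0] T1V by auto
      then have "u - v = ?D1 a" by (simp add: algebra_simps)
      with \<open>a \<in> vecs k\<close> have "u - v \<in> ?D1 ` vecs k" by blast
      then show "x = y" using uniq[OF T1 D1] uv by blast
    qed (use T1V in auto)
    moreover have "index k ?D2 \<noteq> 0" using index2 ne by (auto simp: ecard_def zero_enat_def)
    ultimately show ?thesis using True by (simp add: imult_infinity imult_infinity_right)
  next
    case False
    \<comment> \<open>Uniqueness hinges on this: once \<open>m = 0\<close> and
      \<open>u1 = u2\<close>, the vector \<open>a\<close> lies in the kernel of I - P, and
      \<open>a = 0\<close> is what clears \<open>q a m\<close> and \<open>scale s1 (P a)\<close>
      from the third equation.\<close>
    note inj = index_finite_inj[OF D1 False]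
    let ?T = "T1 \<times> {0, 1 :: int} \<times> T2"
    have "transversal (carrier (heis k)) ?R ?T"
      unfolding transversal_def
    proof (intro conjI ballI)
      show "?T \<subseteq> carrier (heis k)" using T1V T2V by auto
      fix x assume x: "x \<in> carrier (heis k)"
      obtain u s z where usz: "x = (u, s, z)" by (cases x)
      with x have V: "u \<in> vecs k" "z \<in> vecs k" by auto
      \<comment> \<open>The second equation reads \<open>s - 2 m = s'\<close>, so this choice
        reduces \<open>s\<close> to \<open>s mod 2\<close>.\<close>
      define m where "m = s div 2"
      have "u + scale m w \<in> vecs k" using V w by simp
      then obtain u' where u': "u' \<in> T1" "u + scale m w - u' \<in> ?D1 ` vecs k"
        using T1 unfolding transversal_def by (metis coset_rel_iff)
      then obtain a where a: "a \<in> vecs k" "u + scale m w - u' = a - P a" by auto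
      let ?z = "z + q a m + scale s (P a + scale m w) - scale m u'"
      have "?z \<in> vecs k" using V w a q T1V u' endo_closed[OF P] by (intro vecs_closed) auto
      then obtain z' where z': "z' \<in> T2" "?z - z' \<in> ?D2 ` vecs k"
        using T2 unfolding transversal_def by (metis coset_rel_iff)
      then obtain y where y: "y \<in> vecs k" "?z - z' = y + P y" by auto
      have rel: "(x, (u', s mod 2, z')) \<in> ?R"
        unfolding usz
      proof (subst tw)
        have "u + (P a + scale m w) = a + u'" using a(2) by (simp add: algebra_simps)
        moreover have "s - m = m + s mod 2" by (simp add: m_def)
        moreover have "z + (q a m - P y) + scale s (P a + scale m w) = y + z' + scale m u'"
          using y(2) by (simp add: algebra_simps)
        ultimately show "\<exists>a\<in>vecs k. \<exists>m. \<exists>y\<in>vecs k.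
            u + (P a + scale m w) = a + u' \<and> s - m = m + s mod 2 \<and>
            z + (q a m - P y) + scale s (P a + scale m w) = y + z' + scale m u'"
          using a(1) y(1) by blast
      qed (use V T1V T2V u' z' in auto)
      have mem: "(u', s mod 2, z') \<in> ?T" using u' z' by auto
      have unique: "t = t'" if t: "t \<in> ?T" "t' \<in> ?T" "(t, t') \<in> ?R" for t t'
      proof -
        obtain u1 s1 z1 u2 s2 z2 where tt: "t = (u1, s1, z1)" "t' = (u2, s2, z2)"
          by (cases t; cases t')
        have T: "u1 \<in> T1" "u2 \<in> T1" "z1 \<in> T2" "z2 \<in> T2" "s1 \<in> {0, 1}" "s2 \<in> {0, 1}"
          using t tt by auto
        then obtain a m y where am: "a \<in> vecs k" "y \<in> vecs k"
            "u1 + (P a + scale m w) = a + u2" "s1 - m = m + s2"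
            "z1 + (q a m - P y) + scale s1 (P a + scale m w) = y + z2 + scale m u2"
          using t(3) tw[of u1 z1 u2 z2 s1 s2] T1V T2V unfolding tt by blast
        have "m = 0" "s1 = s2" using am(4) T(5,6) by auto
        then have "u1 - u2 = ?D1 a" using am(3) by (simp add: algebra_simps)
        then have "u1 = u2" using am(1) T by (intro uniq[OF T1 D1]) auto
        then have "a = 0" using inj[OF am(1)] \<open>u1 - u2 = ?D1 a\<close> by simp
        then have "z1 - z2 = ?D2 y"
          using am(5) \<open>m = 0\<close> q00 endo_zero[OF P] by (simp add: algebra_simps)
        then have "z1 = z2" using am(2) T by (intro uniq[OF T2 D2]) auto
        then show ?thesis using tt \<open>u1 = u2\<close> \<open>s1 = s2\<close> by simp
      qed
      show "\<exists>!t. t \<in> ?T \<and> (x, t) \<in> ?R"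
      proof (rule ex1I[of _ "(u', s mod 2, z')"])
        fix t assume t: "t \<in> ?T \<and> (x, t) \<in> ?R"
        then have "(t, (u', s mod 2, z')) \<in> ?R"
          using rel eqv by (meson equiv_def symD transD)
        then show "t = (u', s mod 2, z')" by (rule unique[OF conjunct1[OF t] mem])
      qed (intro conjI mem rel)
    qed
    then have "reidemeister (heis k) \<phi> = ecard ?T"
      unfolding reidemeister_ecard by (rule ecard_quotient_transversal[OF eqv])
    also have "\<dots> = ecard T1 * (ecard {0, 1 :: int} * ecard T2)"
      using ne by (simp add: ecard_Times)
    also have "ecard {0, 1 :: int} = 2" by (simp add: ecard_def numeral_eq_enat)
    finally show ?thesis by (simp only: index1 index2 mult.left_commute mult.assoc)
  qed
qed

text \<open>For \<epsilon> = -1 the count depends on \<open>P\<close> alone, so automorphisms with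
  \<open>w = 0\<close> and \<open>q = 0\<close> attain every value; the identity supplies
  \<open>\<infinity>\<close>.\<close>

theorem spec_R_heis:
  assumes "k \<ge> 2"
  shows "spec_R (heis k) = {2 * index k (\<lambda>u. u - P u) * index k (\<lambda>u. u + P u) | P.
    endo k P \<and> bij_betw P (vecs k) (vecs k)} \<union> {\<infinity>}" (is "_ = ?A \<union> _")
proof
  show "spec_R (heis k) \<subseteq> ?A \<union> {\<infinity>}"
    unfolding spec_R_eq_isos[OF group_heis]
  proof
    fix r assume "r \<in> {reidemeister (heis k) \<phi> | \<phi>. \<phi> \<in> iso (heis k) (heis k)}"
    then obtain \<phi> where \<phi>: "\<phi> \<in> iso (heis k) (heis k)" and r: "r = reidemeister (heis k) \<phi>"
      by blast
    then have hom: "\<phi> \<in> hom (heis k) (heis k)" by (simp add: iso_def)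
    obtain P w \<epsilon> q where P: "endo k P" "bij_betw P (vecs k) (vecs k)" "w \<in> vecs k" "\<epsilon> = 1 \<or> \<epsilon> = - 1"
      "\<And>u s. u \<in> vecs k \<Longrightarrow> q u s \<in> vecs k"
      "\<And>u s z. u \<in> vecs k \<Longrightarrow> z \<in> vecs k \<Longrightarrow>
        \<phi> (u, s, z) = (P u + scale s w, \<epsilon> * s, q u s + scale \<epsilon> (P z))"
      using heis_iso_structure[OF assms \<phi>] by metis
    show "r \<in> ?A \<union> {\<infinity>}"
    proof (cases "\<epsilon> = 1")
      case True
      then have "r = \<infinity>"
        unfolding r using P(6) by (intro heis_reidemeister_pos[OF hom]) auto
      then show ?thesis by simp
    next
      case False
      then have "\<epsilon> = - 1" using P(4) by simp
      then have "r = 2 * index k (\<lambda>u. u - P u) * index k (\<lambda>u. u + P u)"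
        unfolding r by (intro heis_reidemeister_neg[OF hom P(1,3,5)]) (simp_all add: P(6))
      then show ?thesis using P by blast
    qed
  qed
  have "reidemeister (heis k) (\<lambda>x. x) = \<infinity>"
    by (rule heis_reidemeister_pos) (auto simp: hom_def)
  then have "\<infinity> \<in> spec_R (heis k)"
    unfolding spec_R_eq_isos[OF group_heis] using iso_set_refl by (metis (mono_tags, lifting) mem_Collect_eq)
  moreover have "2 * index k (\<lambda>u. u - P u) * index k (\<lambda>u. u + P u) \<in> spec_R (heis k)"
    if P: "endo k P" "bij_betw P (vecs k) (vecs k)" for P
  proof -
    let ?\<phi> = "\<lambda>(u, s, z). (P u, - s, - P z)"
    have iso: "?\<phi> \<in> iso (heis k) (heis k)" by (rule heis_neg_iso[OF P])
    then have "reidemeister (heis k) ?\<phi> = 2 * index k (\<lambda>u. u - P u) * index k (\<lambda>u. u + P u)"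
      using P by (intro heis_reidemeister_neg[where w = 0 and q = "\<lambda>_ _. 0"]) (auto simp: iso_def)
    then show ?thesis
      unfolding spec_R_eq_isos[OF group_heis] using iso by (metis (mono_tags, lifting) mem_Collect_eq)
  qed
  ultimately show "?A \<union> {\<infinity>} \<subseteq> spec_R (heis k)" by blast
qed

section \<open>The case k = 2\<close>

lemma index_cong:
  assumes "\<And>u. u \<in> vecs k \<Longrightarrow> D u = D' u"
  shows "index k D = index k D'"
proof -
  have "D ` vecs k = D' ` vecs k" using assms by (intro image_cong) auto
  then show ?thesis by (simp add: index_def coset_rel_def)
qed

lemma endo_2_eq_mat2:
  assumes P: "endo 2 P"
  obtains a b c d where "\<And>u. u \<in> vecs 2 \<Longrightarrow> P u = mat2 a b c d u"
proof (rule that)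
  fix u assume u: "u \<in> vecs 2"
  let ?e1 = "unit_vec 1" and ?e2 = "unit_vec 2"
  have e: "?e1 \<in> vecs 2" "?e2 \<in> vecs 2" by auto
  have "u = scale (u 1) ?e1 + scale (u 2) ?e2"
    using u e by (intro vecs_2_eqI) (auto simp: unit_vec_def)
  then have "P u = P (scale (u 1) ?e1 + scale (u 2) ?e2)" by simp
  also have "\<dots> = scale (u 1) (P ?e1) + scale (u 2) (P ?e2)"
    using e by (simp only: endo_add[OF P] endo_scale[OF P] vecs_closed)
  also have "\<dots> = mat2 (P ?e1 1) (P ?e2 1) (P ?e1 2) (P ?e2 2) u"
    using endo_closed[OF P] e by (intro vecs_2_eqI vecs_closed mat2_closed) (auto simp: mat2_def)
  finally show "P u = mat2 (P ?e1 1) (P ?e2 1) (P ?e1 2) (P ?e2 2) u" .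
qed

text \<open>Preimages of the unit vectors are the columns of an integer inverse, so the determinant
  divides 1.\<close>

lemma det_mat2_bij:
  assumes "bij_betw (mat2 a b c d) (vecs 2) (vecs 2)"
  shows "a * d - b * c = 1 \<or> a * d - b * c = - 1"
proof -
  have "unit_vec 1 \<in> mat2 a b c d ` vecs 2" "unit_vec 2 \<in> mat2 a b c d ` vecs 2"
    using assms by (auto simp: bij_betw_def)
  then obtain f g where "unit_vec 1 = mat2 a b c d f" "unit_vec 2 = mat2 a b c d g" by blast
  from fun_cong[OF this(1), of 1] fun_cong[OF this(1), of 2] fun_cong[OF this(2), of 1] fun_cong[OF this(2), of 2]
  have "1 = a * f 1 + b * f 2" "0 = c * f 1 + d * f 2" "0 = a * g 1 + b * g 2" "1 = c * g 1 + d * g 2"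
    by (simp_all add: unit_vec_def mat2_def)
  then have "(a * d - b * c) * (f 1 * g 2 - f 2 * g 1) = 1" by algebra
  then show ?thesis by (auto simp: zmult_eq_1_iff)
qed

lemma bij_mat2:
  assumes "a * d - b * c = \<delta>" "\<delta> = 1 \<or> \<delta> = - 1"
  shows "bij_betw (mat2 a b c d) (vecs 2) (vecs 2)"
proof (rule bij_betwI)
  have \<delta>: "\<delta> * \<delta> = 1" using assms(2) by auto
  \<comment> \<open>The adjugate divided by the determinant, since \<open>\<delta>\<close> is its
    own inverse.\<close>
  let ?Q = "mat2 (\<delta> * d) (- \<delta> * b) (- \<delta> * c) (\<delta> * a)"
  show "mat2 a b c d \<in> vecs 2 \<rightarrow> vecs 2" "?Q \<in> vecs 2 \<rightarrow> vecs 2" by (simp_all add: mat2_closed)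
  show "?Q (mat2 a b c d f) = f" if "f \<in> vecs 2" for f
  proof (rule vecs_2_eqI[OF mat2_closed that])
    have "\<delta> * d * (a * f 1 + b * f 2) + - \<delta> * b * (c * f 1 + d * f 2) = \<delta> * (a * d - b * c) * f 1"
      by (simp add: algebra_simps)
    then show "?Q (mat2 a b c d f) 1 = f 1" by (simp add: mat2_def assms(1) \<delta>)
    have "- \<delta> * c * (a * f 1 + b * f 2) + \<delta> * a * (c * f 1 + d * f 2) = \<delta> * (a * d - b * c) * f 2"
      by (simp add: algebra_simps)
    then show "?Q (mat2 a b c d f) 2 = f 2" by (simp add: mat2_def assms(1) \<delta>)
  qed
  show "mat2 a b c d (?Q f) = f" if "f \<in> vecs 2" for f
  proof (rule vecs_2_eqI[OF mat2_closed that])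
    have "a * (\<delta> * d * f 1 + - \<delta> * b * f 2) + b * (- \<delta> * c * f 1 + \<delta> * a * f 2) = \<delta> * (a * d - b * c) * f 1"
      by (simp add: algebra_simps)
    then show "mat2 a b c d (?Q f) 1 = f 1" by (simp add: mat2_def assms(1) \<delta>)
    have "c * (\<delta> * d * f 1 + - \<delta> * b * f 2) + d * (- \<delta> * c * f 1 + \<delta> * a * f 2) = \<delta> * (a * d - b * c) * f 2"
      by (simp add: algebra_simps)
    then show "mat2 a b c d (?Q f) 2 = f 2" by (simp add: mat2_def assms(1) \<delta>)
  qed
qed

text \<open>\<open>det (I - M)\<close> and \<open>det (I + M)\<close> are
  \<open>1 + \<delta>\<close> minus and plus the trace, so their product is a difference of
  squares.\<close>

lemma index_id_mat2:
  assumes \<delta>: "a * d - b * c = \<delta>"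
  shows "index 2 (\<lambda>u. u - mat2 a b c d u) * index 2 (\<lambda>u. u + mat2 a b c d u) = iabs ((1 + \<delta>)\<^sup>2 - (a + d)\<^sup>2)"
proof -
  have "index 2 (\<lambda>u. u - mat2 a b c d u) = index 2 (mat2 (1 - a) (- b) (- c) (1 - d))"
    by (rule index_cong) (auto simp: mat2_def fun_eq_iff vecs_2_iff algebra_simps)
  moreover have "index 2 (\<lambda>u. u + mat2 a b c d u) = index 2 (mat2 (1 + a) b c (1 + d))"
    by (rule index_cong) (auto simp: mat2_def fun_eq_iff vecs_2_iff algebra_simps)
  moreover have "((1 - a) * (1 - d) - (- b) * (- c)) * ((1 + a) * (1 + d) - b * c) = (1 + \<delta>)\<^sup>2 - (a + d)\<^sup>2"
    unfolding \<delta>[symmetric] by (simp add: algebra_simps power2_eq_square)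
  ultimately show ?thesis by (simp only: index_mat2 iabs_mult)
qed

theorem spec_R_heis_2:
  "spec_R (heis 2) = {2 * iabs ((1 + \<delta>)\<^sup>2 - \<tau>\<^sup>2) | \<delta> \<tau>. \<delta> = 1 \<or> \<delta> = - 1} \<union> {\<infinity>}"
    (is "_ = ?B \<union> _")
proof -
  let ?A = "{2 * index 2 (\<lambda>u. u - P u) * index 2 (\<lambda>u. u + P u) | P.
    endo 2 P \<and> bij_betw P (vecs 2) (vecs 2)}"
  have "?A \<subseteq> ?B"
  proof clarify
    fix P assume P: "endo 2 P" "bij_betw P (vecs 2) (vecs 2)"
    obtain a b c d where M: "\<And>u. u \<in> vecs 2 \<Longrightarrow> P u = mat2 a b c d u"
      using endo_2_eq_mat2[OF P(1)] by metis
    then have "bij_betw (mat2 a b c d) (vecs 2) (vecs 2)"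
      using P(2) bij_betw_cong by metis
    then have \<delta>: "a * d - b * c = 1 \<or> a * d - b * c = - 1" by (rule det_mat2_bij)
    have "index 2 (\<lambda>u. u - P u) * index 2 (\<lambda>u. u + P u) =
        index 2 (\<lambda>u. u - mat2 a b c d u) * index 2 (\<lambda>u. u + mat2 a b c d u)"
      by (intro arg_cong2[where f = times] index_cong) (simp_all add: M)
    then have "2 * index 2 (\<lambda>u. u - P u) * index 2 (\<lambda>u. u + P u) =
        2 * iabs ((1 + (a * d - b * c))\<^sup>2 - (a + d)\<^sup>2)"
      by (simp only: index_id_mat2 mult.assoc)
    with \<delta> show "\<exists>\<delta> \<tau>. 2 * index 2 (\<lambda>u. u - P u) * index 2 (\<lambda>u. u + P u) =
        2 * iabs ((1 + \<delta>)\<^sup>2 - \<tau>\<^sup>2) \<and> (\<delta> = 1 \<or> \<delta> = - 1)"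
      by blast
  qed
  moreover have "?B \<subseteq> ?A"
  proof clarify
    fix \<delta> \<tau> :: int assume \<delta>: "\<delta> = 1 \<or> \<delta> = - 1"
    \<comment> \<open>The companion matrix of \<open>x^2 - \<tau> x + \<delta>\<close>, with trace
      \<open>\<tau>\<close> and determinant \<open>\<delta>\<close>.\<close>
    let ?P = "mat2 0 (- \<delta>) 1 \<tau>"
    have "2 * iabs ((1 + \<delta>)\<^sup>2 - \<tau>\<^sup>2) = 2 * index 2 (\<lambda>u. u - ?P u) * index 2 (\<lambda>u. u + ?P u)"
      by (simp only: mult.assoc index_id_mat2[OF HOL.refl]) simp
    moreover have "bij_betw ?P (vecs 2) (vecs 2)" by (rule bij_mat2[OF _ \<delta>]) simp
    ultimately show "\<exists>P. 2 * iabs ((1 + \<delta>)\<^sup>2 - \<tau>\<^sup>2) = 2 * index 2 (\<lambda>u. u - P u) * index 2 (\<lambda>u. u + P u) \<and>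
        endo 2 P \<and> bij_betw P (vecs 2) (vecs 2)"
      using endo_mat2 by blast
  qed
  ultimately show ?thesis by (simp add: spec_R_heis)
qed

section \<open>The case of k at least 3\<close>

lemma odd_index_minus_iff_plus:
  assumes P: "endo k P" and "index k (\<lambda>u. u - P u) = enat M" "index k (\<lambda>u. u + P u) = enat N"
  shows "odd M \<longleftrightarrow> odd N"
proof -
  have D: "endo k (\<lambda>u. u - P u)" "endo k (\<lambda>u. u + P u)"
    using P by (simp_all add: endo_fun_add endo_fun_diff endo_id)
  have "(\<exists>b\<in>vecs k. v = (a - P a) + scale 2 b) \<longleftrightarrow> (\<exists>b\<in>vecs k. v = (a + P a) + scale 2 b)"
    if "a \<in> vecs k" for a v
  proof -
    \<comment> \<open>The discrepancy \<open>2 P a\<close> is absorbed into the doubled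
      vector.\<close>
    have "(a - P a) + scale 2 b = (a + P a) + scale 2 (b - P a)"
      "(a + P a) + scale 2 b = (a - P a) + scale 2 (b + P a)" for b
      by (simp_all add: fun_eq_iff)
    then show ?thesis
      using that endo_closed[OF P that] vecs_closed(2,3) by metis
  qed
  then show ?thesis
    unfolding odd_index_iff[OF D(1) assms(2)] odd_index_iff[OF D(2) assms(3)] by (metis (no_types, lifting))
qed

text \<open>The polynomial is \<open>x^k + a x^2 + b x + 1\<close>: constant term 1 gives
  invertibility, and \<open>k \<ge> 3\<close> makes room for the second free coefficient
  \<open>a\<close>.\<close>

lemma companion_indices:
  assumes k: "k \<ge> 3" and "even (m - t)"
  obtains P where "endo k P" "bij_betw P (vecs k) (vecs k)"
    "index k (\<lambda>u. u - P u) = iabs m" "index k (\<lambda>u. u + P u) = iabs t"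
proof -
  \<comment> \<open>The indices come from \<open>2 + a + b\<close> and from \<open>2 + a - b\<close>
    for even \<open>k\<close> or \<open>b - a\<close> for odd \<open>k\<close>. With
    \<open>b = a + e\<close> this \<open>e\<close> makes the second equal to \<open>t\<close>; the
    first equals \<open>m\<close> when \<open>2 a = m - 2 - e\<close>, which the parity hypothesis
    makes solvable.\<close>
  define e where "e = (if even k then 2 - t else t)"
  define a where "a = (m - 2 - e) div 2"
  define b where "b = a + e"
  have "even (m - 2 - e)" using assms(2) by (auto simp: e_def)
  then have a2: "2 * a = m - 2 - e" by (simp add: a_def)
  define c :: "nat \<Rightarrow> int" where "c i = (if i = 1 then 1 else if i = 2 then b else if i = 3 then a else 0)" for i
  have sum: "(\<Sum>i=1..k. f i * c i) = f 1 + f 2 * b + f 3 * a" for f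
  proof -
    have "(\<Sum>i=1..k. f i * c i) = (\<Sum>i\<in>{1, 2, 3}. f i * c i)"
      using k by (intro sum.mono_neutral_right) (auto simp: c_def)
    then show ?thesis by (simp add: c_def)
  qed
  show ?thesis
  proof (rule that[of "companion k c"])
    show "endo k (companion k c)" by (rule endo_companion)
    show "bij_betw (companion k c) (vecs k) (vecs k)" using k by (intro bij_companion) (auto simp: c_def)
    have "1 + (\<Sum>i=1..k. c i) = m" using sum[of "\<lambda>_. 1"] a2 by (simp add: b_def)
    then show "index k (\<lambda>u. u - companion k c u) = iabs m"
      using k by (simp add: index_id_minus_companion)
    have "1 - (\<Sum>i=1..k. (-1) ^ (i + k) * c i) = t \<or> 1 - (\<Sum>i=1..k. (-1) ^ (i + k) * c i) = - t"
      unfolding sum using a2 by (cases "even k") (simp_all add: b_def e_def)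
    then show "index k (\<lambda>u. u + companion k c u) = iabs t"
      using k by (auto simp: index_id_plus_companion)
  qed
qed

text \<open>Finite indices \<open>M\<close>, \<open>N\<close> of equal parity make
  \<open>2 M N\<close> twice an odd number or a multiple of 8; the pairs \<open>(2 j - 1, 1)\<close>
  and \<open>(2 j, 2)\<close> already attain all of these.\<close>

theorem spec_R_heis_ge_3:
  assumes k: "k \<ge> 3"
  shows "spec_R (heis k) = {enat (2 * (2 * j - 1)) | j. j \<ge> 1} \<union> {enat (8 * j) | j. j \<ge> 1} \<union> {\<infinity>}"
    (is "_ = ?B \<union> ?C \<union> _")
proof -
  let ?A = "{2 * index k (\<lambda>u. u - P u) * index k (\<lambda>u. u + P u) | P.
    endo k P \<and> bij_betw P (vecs k) (vecs k)}"
  have sub: "?A \<subseteq> ?B \<union> ?C \<union> {\<infinity>}"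
  proof
    fix r assume "r \<in> ?A"
    then obtain P where P: "endo k P" and r: "r = 2 * index k (\<lambda>u. u - P u) * index k (\<lambda>u. u + P u)"
      by blast
    have D: "endo k (\<lambda>u. u - P u)" "endo k (\<lambda>u. u + P u)"
      using P by (simp_all add: endo_fun_add endo_fun_diff endo_id)
    show "r \<in> ?B \<union> ?C \<union> {\<infinity>}"
    proof (cases "r = \<infinity>")
      case False
      obtain M N where MN: "index k (\<lambda>u. u - P u) = enat M" "index k (\<lambda>u. u + P u) = enat N"
      proof -
        \<comment> \<open>A zero factor would absorb \<open>\<infinity>\<close> in
          \<open>enat\<close>; excluding it lets finiteness of the product pass to both
          factors.\<close>
        have "index k (\<lambda>u. u - P u) \<noteq> 0" "index k (\<lambda>u. u + P u) \<noteq> 0"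
          using index_multiple(1)[OF D(1), of 0] index_multiple(1)[OF D(2), of 0]
          by (auto simp: zero_enat_def)
        then have "index k (\<lambda>u. u - P u) \<noteq> \<infinity>" "index k (\<lambda>u. u + P u) \<noteq> \<infinity>"
          using False r by (auto simp: imult_is_infinity)
        then show ?thesis using that by auto
      qed
      have pos: "M > 0" "N > 0" using index_multiple(1) D MN by blast+
      have r': "r = enat (2 * (M * N))" by (simp add: r MN numeral_eq_enat mult.assoc)
      show ?thesis
      proof (cases "odd M")
        case True
        then have "odd (M * N)" using odd_index_minus_iff_plus[OF P MN] by simp
        then obtain j where "M * N = 2 * j + 1" by (rule oddE)
        then have "r = enat (2 * (2 * Suc j - 1))" by (simp add: r')
        then show ?thesis by force
      next
        case False
        then obtain i j where "M = 2 * i" "N = 2 * j"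
          using odd_index_minus_iff_plus[OF P MN] by (meson evenE)
        then have "r = enat (8 * (i * j))" "i * j \<ge> 1" using pos by (simp_all add: r')
        then show ?thesis by blast
      qed
    qed simp
  qed
  have hit: "2 * iabs m * iabs t \<in> ?A" if even: "even (m - t)" for m t
  proof -
    obtain P where "endo k P" "bij_betw P (vecs k) (vecs k)"
      "index k (\<lambda>u. u - P u) = iabs m" "index k (\<lambda>u. u + P u) = iabs t"
      using companion_indices[OF k even] .
    then show ?thesis by (metis (mono_tags, lifting) mem_Collect_eq)
  qed
  have B: "?B \<subseteq> ?A"
  proof clarify
    fix j :: nat assume j: "j \<ge> 1"
    have "enat (2 * (2 * j - 1)) = 2 * iabs (2 * int j - 1) * iabs 1"
      using j by (simp add: iabs_def numeral_eq_enat nat_diff_distrib nat_mult_distrib one_enat_def)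
    with hit[of "2 * int j - 1" 1] show "\<exists>P. enat (2 * (2 * j - 1)) =
        2 * index k (\<lambda>u. u - P u) * index k (\<lambda>u. u + P u) \<and> endo k P \<and> bij_betw P (vecs k) (vecs k)"
      by simp
  qed
  have C: "?C \<subseteq> ?A"
  proof clarify
    fix j :: nat assume j: "j \<ge> 1"
    have "enat (8 * j) = 2 * iabs (2 * int j) * iabs 2"
      using j by (simp add: iabs_def numeral_eq_enat nat_mult_distrib)
    with hit[of "2 * int j" 2] show "\<exists>P. enat (8 * j) =
        2 * index k (\<lambda>u. u - P u) * index k (\<lambda>u. u + P u) \<and> endo k P \<and> bij_betw P (vecs k) (vecs k)"
      by simp
  qed
  have "X \<union> W = Y \<union> Z \<union> W" if "X \<subseteq> Y \<union> Z \<union> W" "Y \<subseteq> X" "Z \<subseteq> X" for X Y Z W :: "enat set"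
    using that by blast
  from this[OF sub B C] show ?thesis using spec_R_heis[of k] k by simp
qed

section \<open>Transfer to the graph group\<close>

theorem theorem7p2:
  fixes n :: nat
  assumes "n \<ge> 3"
  shows "spec_R (graph_group n (Gamma_edge n)) =
    (if n = 3 then
        {enat (2 * nat (m ^ 2)) | m :: int. m \<noteq> 0}
      \<union> {(if m ^ 2 = 4 then \<infinity> else enat (2 * nat \<bar>m ^ 2 - 4\<bar>)) | m :: int. True}
      \<union> {\<infinity>}
     else
        {enat (2 * (2 * k - 1)) | k :: nat. k \<ge> 1}
      \<union> {enat (8 * k) | k :: nat. k \<ge> 1}
      \<union> {\<infinity>})"
proof -
  obtain k where k: "n = Suc k" "k \<ge> 2" using assms by (cases n) auto
  then obtain h where "h \<in> iso (heis k) (graph_group n (Gamma_edge n))"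
    using graph_group_iso_heis[of k] by auto
  then have spec: "spec_R (graph_group n (Gamma_edge n)) = spec_R (heis k)"
    using spec_R_cong_iso[OF group_heis] group_presented_group unfolding graph_group_def by metis
  show ?thesis
  proof (cases "n = 3")
    case True
    \<comment> \<open>Determinant -1 contributes the squares, with \<open>\<infinity>\<close> at
      \<open>m = 0\<close> covered by the singleton; determinant 1 contributes
      \<open>4 - m\<^sup>2\<close>, whose sign \<open>iabs\<close> forgets.\<close>
    have neg: "2 * iabs ((1 + - 1)\<^sup>2 - m\<^sup>2) = (if m = 0 then \<infinity> else enat (2 * nat (m\<^sup>2)))" for m
      by (simp add: iabs_def numeral_eq_enat)
    have pos: "2 * iabs ((1 + 1)\<^sup>2 - m\<^sup>2) = (if m\<^sup>2 = 4 then \<infinity> else enat (2 * nat \<bar>m\<^sup>2 - 4\<bar>))" for m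
      by (auto simp: iabs_def numeral_eq_enat abs_minus_commute)
    have "{2 * iabs ((1 + \<delta>)\<^sup>2 - \<tau>\<^sup>2) | \<delta> \<tau>. \<delta> = 1 \<or> \<delta> = - 1} =
        {2 * iabs ((1 + 1)\<^sup>2 - \<tau>\<^sup>2) | \<tau>. True} \<union> {2 * iabs ((1 + - 1)\<^sup>2 - \<tau>\<^sup>2) | \<tau>. True}"
      by blast
    then show ?thesis
      using True k unfolding spec by (simp only: neg pos) (auto simp: spec_R_heis_2)
  next
    case False
    then have "k \<ge> 3" using k by simp
    from spec_R_heis_ge_3[OF this] show ?thesis using False unfolding spec by simp
  qed
qed

end
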